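(* Let $s:\mathbb{R}_+\to\mathbb{R}$ be a non-decreasing continuous function, let $\Omega_s$ be the rotating half-plane with rotation function $s$, and let $f$ be an entire function of finite exponential type which is bounded on $\Omega_s$. If $$\limsup_{r\to\infty}\frac{s(r)}{\sqrt{\log r}}>0,$$ then $f$ is constant.
   Context: For a non-decreasing continuous function $s:\mathbb{R}_+\to\mathbb{R}$, the rotating half-plane with rotation function $s$ is $$\Omega_s=\{re^{i\alpha}\mid r>0,\ s(r)<\alpha<s(r)+\pi\}.$$ An entire function $F$ is of finite exponential type if there are constants $A,B>0$ with $|F(z)|\le A e^{B|z|}$ for all $z\in\mathbb{C}$. *)

theory Defs
  imports "HOL-Complex_Analysis.Complex_Analysis"
begin

text \<open>Only the values of \<open>s\<close> on the positive reals enter. The angle \<open>\<alpha>\<close> is an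
  arbitrary real number, not a principal argument.\<close>

definition rotating_half_plane :: "(real \<Rightarrow> real) \<Rightarrow> complex set" where
  "rotating_half_plane s =
     {complex_of_real r * exp (\<i> * complex_of_real \<alpha>) | r \<alpha>. r > 0 \<and> s r < \<alpha> \<and> \<alpha> < s r + pi}"

definition finite_exponential_type :: "(complex \<Rightarrow> complex) \<Rightarrow> bool" where
  "finite_exponential_type F \<longleftrightarrow>
     (\<exists>A B::real. A > 0 \<and> B > 0 \<and> (\<forall>z. norm (F z) \<le> A * exp (B * norm z)))"

end

(*
Write the nonnegative subharmonic function u = Psi(|f/M|^2), where Psi is a smooth version of log^+, in
logarithmic coordinates (t, h). It vanishes for S t <= h <= S t + pi, where S t = s (exp t).
Following Carleman, let N(t) be the L^2 norm of u(t, .) on the circle and omega = u / N. Then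
  N'' >= (1 + q) N,   q = (|omega_h|^2 - 1) + |omega_t|^2 >= 0.
The first summand of q controls the distance of omega(t) from the extremal h |-> sin (S t - h) of
Wirtinger's inequality on the half circle, the second one the speed of omega. So the integral of q over
two consecutive unit intervals bounds the square of the rotation of S between suitable points of them.
Exponential type means N = O(exp t), which forces q to be integrable unless u = 0. Hence
the increments of S over unit steps are square summable, so S t = o(sqrt t), against the hypothesis.
*)
theory Submission
  imports Defs
begin

subsection \<open>Integrals and Wirtinger's inequality\<close>

text \<open>Integrability of q rests on the factorisation N'' - N = (d/dt - 1)(d/dt + 1) N. It makes
  \<open>p\<close> = (N' + N) exp (- t) satisfy p' >= N exp (- t) q, so \<open>p\<close> is
  nondecreasing. Being positive, \<open>p\<close> keeps N exp (- t) above a positive constant, while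
  the exponential type bounds N exp (- t) and with it \<open>p\<close>. So q need not be integrated:
  unit increments of \<open>p\<close> stand for its integrals, and the mean value theorem supplies
  points at which q itself is small. Such points are needed because the direction of the half-plane
  is read off at single values of t, from the first Fourier coefficient of omega. That coefficient
  knows the direction only modulo 2 pi; an intermediate value argument removes the ambiguity.
  Finally, N is differentiated only where it is positive, and monotonicity of its square makes
  positivity persist.\<close>

lemma Cauchy_Schwarz_integral:
  fixes f g :: "real \<Rightarrow> real"
  assumes f: "continuous_on {a..b} f" and g: "continuous_on {a..b} g"
  shows "(integral {a..b} (\<lambda>x. f x * g x))\<^sup>2
         \<le> integral {a..b} (\<lambda>x. (f x)\<^sup>2) * integral {a..b} (\<lambda>x. (g x)\<^sup>2)"
proof -
  define A where "A = integral {a..b} (\<lambda>x. (f x)\<^sup>2)"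
  define B where "B = integral {a..b} (\<lambda>x. f x * g x)"
  define C where "C = integral {a..b} (\<lambda>x. (g x)\<^sup>2)"
  have ints: "(\<lambda>x. (f x)\<^sup>2) integrable_on {a..b}" "(\<lambda>x. f x * g x) integrable_on {a..b}"
    "(\<lambda>x. (g x)\<^sup>2) integrable_on {a..b}"
    by (intro integrable_continuous_interval continuous_intros f g)+
  \<comment> \<open>Two multipliers instead of one let \<open>f\<close> and \<open>g\<close>
    exchange roles when \<open>C\<close> = 0.\<close>
  have quad: "0 \<le> l\<^sup>2 * A + 2 * l * k * B + k\<^sup>2 * C" for l k
  proof -
    have h: "((\<lambda>x. l\<^sup>2 * (f x)\<^sup>2 + 2 * l * k * (f x * g x) + k\<^sup>2 * (g x)\<^sup>2)
        has_integral l\<^sup>2 * A + 2 * l * k * B + k\<^sup>2 * C) {a..b}"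
      unfolding A_def B_def C_def
      by (intro has_integral_add has_integral_mult_right integrable_integral ints)
    have "l\<^sup>2 * (f x)\<^sup>2 + 2 * l * k * (f x * g x) + k\<^sup>2 * (g x)\<^sup>2 = (l * f x + k * g x)\<^sup>2" for x
      by (simp add: power2_eq_square algebra_simps)
    then show ?thesis
      by (intro has_integral_nonneg[OF h]) simp
  qed
  have "B\<^sup>2 \<le> A * C"
  proof (cases "C = 0")
    case True
    show ?thesis
    proof (cases "A = 0")
      case True
      with \<open>C = 0\<close> quad[of 1 1] quad[of 1 "-1"] show ?thesis by simp
    next
      case False
      moreover have "A \<ge> 0" using quad[of 1 0] by simp
      ultimately have "A > 0" by simp
      moreover have "0 \<le> - (A * B\<^sup>2)"
        using quad[of "-B" A] \<open>C = 0\<close> by (simp add: power2_eq_square algebra_simps)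
      ultimately show ?thesis using True by (simp add: mult_le_0_iff)
    qed
  next
    case False
    moreover have "C \<ge> 0" using quad[of 0 1] by simp
    ultimately have "C > 0" by simp
    have "0 \<le> C * (A * C - B\<^sup>2)"
      using quad[of C "-B"] by (simp add: power2_eq_square algebra_simps)
    with \<open>C > 0\<close> show ?thesis by (simp add: zero_le_mult_iff)
  qed
  then show ?thesis by (simp add: A_def B_def C_def)
qed

lemma integral_periodic:
  fixes g :: "real \<Rightarrow> real"
  assumes g: "continuous_on UNIV g" and per: "\<And>x. g (x + T) = g x" and "T \<ge> 0"
  shows "integral {a..a+T} g = integral {0..T} g"
proof -
  \<comment> \<open>The margins put all end points that occur into the interior of
    \<open>{c..d}\<close>, where the indefinite integral has two-sided derivatives.\<close>
  define c where "c = min a 0 - 1"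
  define d where "d = max a 0 + T + 1"
  have cont: "continuous_on S g" for S using g continuous_on_subset by blast
  have D: "((\<lambda>y. integral {c..y} g) has_real_derivative g x) (at x)" if "c < x" "x < d" for x
  proof -
    have "((\<lambda>y. integral {c..y} g) has_vector_derivative g x) (at x within {c..d})"
      using that by (intro integral_has_vector_derivative cont) auto
    then show ?thesis
      using that by (simp add: at_within_Icc_at has_real_derivative_iff_has_vector_derivative)
  qed
  define J where "J = (\<lambda>x. integral {c..x+T} g - integral {c..x} g)"
  have "(J has_real_derivative 0) (at x)" if "min a 0 \<le> x" "x \<le> max a 0" for x
  proof -
    have "c < x" "x < d" "c < x + T" "x + T < d"
      using that \<open>T \<ge> 0\<close> by (auto simp: c_def d_def)
    then have "(J has_real_derivative g (x + T) - g x) (at x)"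
      unfolding J_def using D[of x] D[of "x + T", unfolded DERIV_shift]
      by (intro DERIV_diff) auto
    then show ?thesis by (simp add: per)
  qed
  then have "\<exists>k. \<forall>x\<in>{min a 0..max a 0}. J x = k"
    by (intro has_field_derivative_zero_constant) (auto intro: has_field_derivative_at_within)
  then have "J a = J 0" by fastforce
  moreover have "J x = integral {x..x+T} g" if "c \<le> x" for x
    using Henstock_Kurzweil_Integration.integral_combine[of c x "x+T" g] that \<open>T \<ge> 0\<close>
    by (simp add: J_def integrable_continuous_interval cont)
  ultimately show ?thesis by (simp add: c_def)
qed

section \<open>Wirtinger's inequality on a half circle, with its deficit\<close>

lemma tendsto_square_over_simple_zero:
  fixes w v :: "real \<Rightarrow> real"
  assumes w: "(w has_real_derivative d) (at p)" and v: "(v has_real_derivative e) (at p)"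
    and "w p = 0" "v p = 0" "e \<noteq> 0"
  shows "((\<lambda>x. (w x)\<^sup>2 / v x) \<longlongrightarrow> 0) (at p)"
proof -
  \<comment> \<open>Numerator and denominator are divided by x - p: a double zero beats a simple
    one. This will remove the boundary terms w^2 cot in Wirtinger's inequality.\<close>
  have "((\<lambda>x. w x * (w x / (x - p)) / (v x / (x - p))) \<longlongrightarrow> 0 * d / e) (at p)"
    using assms DERIV_isCont[OF w]
    by (intro tendsto_intros) (auto simp: has_field_derivative_iff isCont_def)
  moreover have "\<forall>\<^sub>F x in at p. w x * (w x / (x - p)) / (v x / (x - p)) = (w x)\<^sup>2 / v x"
    by (auto simp: eventually_at_filter power2_eq_square)
  ultimately have "((\<lambda>x. (w x)\<^sup>2 / v x) \<longlongrightarrow> 0 * d / e) (at p)"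
    by (rule Lim_transform_eventually)
  then show ?thesis by simp
qed

text \<open>The substitution \<open>w = k sin\<close> turns the deficit \<open>\<integral> w'\<^sup>2 - w\<^sup>2\<close> into
  \<open>\<integral> k'\<^sup>2 sin\<^sup>2\<close>; this controls the oscillation of \<open>k\<close> about its value in the middle.\<close>

lemma Wirtinger_deficit:
  fixes w w' :: "real \<Rightarrow> real"
  assumes w: "\<And>x. (w has_real_derivative w' x) (at x)" and w': "continuous_on UNIV w'"
    and "w a = 0" "w (a + pi) = 0"
  shows "integral {a..a+pi} (\<lambda>x. (w x - w (a + pi/2) * sin (x - a))\<^sup>2)
         \<le> pi * (integral {a..a+pi} (\<lambda>x. (w' x)\<^sup>2) - integral {a..a+pi} (\<lambda>x. (w x)\<^sup>2))"
proof -
  define b where "b = a + pi"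
  define c where "c = a + pi/2"
  \<comment> \<open>In the substitution w = k sin this is k' sin.\<close>
  define g where "g = (\<lambda>x. w' x - w x * cot (x - a))"
  define E where "E = integral {a..b} (\<lambda>x. (w' x)\<^sup>2) - integral {a..b} (\<lambda>x. (w x)\<^sup>2)"
  have cw: "continuous_on S w" for S
    using DERIV_isCont[OF w] by (intro continuous_at_imp_continuous_on) blast
  have cw': "continuous_on S w'" for S using w' continuous_on_subset by blast
  have sin_pos: "sin (x - a) > 0" if "a < x" "x < b" for x
    using that by (intro sin_gt_zero) (auto simp: b_def)
  \<comment> \<open>Because 1/sin^2 = 1 + cot^2, its derivative is w'^2 - w^2 - g^2. As it vanishes
    at both ends, the deficit \<open>E\<close> is the integral of g^2.\<close>
  define F where "F = (\<lambda>x. (w x)\<^sup>2 * cot (x - a))"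
  have F': "(F has_real_derivative (w' x)\<^sup>2 - (w x)\<^sup>2 - (g x)\<^sup>2) (at x)" if "a < x" "x < b" for x
  proof -
    have "(F has_real_derivative 2 * w x * w' x * cot (x - a) - (w x)\<^sup>2 / (sin (x - a))\<^sup>2) (at x)"
      unfolding F_def using sin_pos[OF that]
      by (auto intro!: derivative_eq_intros DERIV_cot[THEN DERIV_chain2] w simp: field_simps)
    moreover have "2 * w x * w' x * cot (x - a) - (w x)\<^sup>2 / (sin (x - a))\<^sup>2
        = (w' x)\<^sup>2 - (w x)\<^sup>2 - (g x)\<^sup>2"
    proof -
      have "1 / (sin (x - a))\<^sup>2 = 1 + (cot (x - a))\<^sup>2"
        using sin_pos[OF that] by (simp add: cot_def field_simps)
      then have *: "(w x)\<^sup>2 / (sin (x - a))\<^sup>2 = (w x)\<^sup>2 * (1 + (cot (x - a))\<^sup>2)"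
        by (metis times_divide_eq_right mult.right_neutral)
      show ?thesis unfolding * g_def by (simp add: power2_eq_square algebra_simps)
    qed
    ultimately show ?thesis by simp
  qed
  have F_end: "isCont F x" if "x = a \<or> x = b" for x
  proof -
    have "((\<lambda>x. sin (x - a)) has_real_derivative cos (x - a)) (at x)"
      by (auto intro!: derivative_eq_intros)
    moreover have "w x = 0" "sin (x - a) = 0" "cos (x - a) \<noteq> 0"
      using that assms by (auto simp: b_def)
    ultimately have "((\<lambda>x. (w x)\<^sup>2 / sin (x - a)) \<longlongrightarrow> 0) (at x)"
      using tendsto_square_over_simple_zero w by blast
    then have "((\<lambda>y. ((w y)\<^sup>2 / sin (y - a)) * cos (y - a)) \<longlongrightarrow> 0 * cos (x - a)) (at x)"
      by (intro tendsto_intros)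
    then show ?thesis using \<open>w x = 0\<close> by (simp add: isCont_def F_def cot_def)
  qed
  have "continuous_on {a..b} F"
  proof (rule continuous_at_imp_continuous_on, rule ballI)
    fix x assume "x \<in> {a..b}"
    then show "isCont F x"
      using F_end F' DERIV_isCont by (metis atLeastAtMost_iff order_le_less)
  qed
  then have "((\<lambda>x. (w' x)\<^sup>2 - (w x)\<^sup>2 - (g x)\<^sup>2) has_integral F b - F a) {a..b}"
    using F' by (intro fundamental_theorem_of_calculus_interior)
      (auto simp: b_def has_real_derivative_iff_has_vector_derivative)
  moreover have "((\<lambda>x. (w' x)\<^sup>2 - (w x)\<^sup>2) has_integral E) {a..b}" unfolding E_def
    by (intro has_integral_diff integrable_integral integrable_continuous_interval continuous_intros cw cw')
  ultimately have "((\<lambda>x. (w' x)\<^sup>2 - (w x)\<^sup>2 - ((w' x)\<^sup>2 - (w x)\<^sup>2 - (g x)\<^sup>2))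
      has_integral E - (F b - F a)) {a..b}"
    by (rule has_integral_diff[rotated])
  moreover have "F a = 0" "F b = 0"
    using assms by (simp_all add: F_def b_def)
  ultimately have gE: "((\<lambda>x. (g x)\<^sup>2) has_integral E) {a..b}"
    by simp
  have "E \<ge> 0" using has_integral_nonneg[OF gE] by simp
  \<comment> \<open>The increment of k = w / sin is the integral of g times 1/sin; Cauchy-Schwarz
    applies, and 1/sin^2 has the primitive -cot.\<close>
  have osc: "(w y / sin (y - a) - w x / sin (x - a))\<^sup>2 \<le> E * (cot (x - a) - cot (y - a))"
    if "a < x" "x \<le> y" "y < b" for x y
  proof -
    have nz: "sin (z - a) \<noteq> 0" if "z \<in> {x..y}" for z
      using sin_pos[of z] that \<open>a < x\<close> \<open>y < b\<close> by auto
    have cg: "continuous_on {x..y} g" unfolding g_def cot_def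
      using nz by (intro continuous_intros cw cw') auto
    have ci: "continuous_on {x..y} (\<lambda>z. 1 / sin (z - a))"
      using nz by (intro continuous_intros) auto
    have k: "((\<lambda>z. g z * (1 / sin (z - a))) has_integral w y / sin (y - a) - w x / sin (x - a)) {x..y}"
      using \<open>x \<le> y\<close>
    proof (rule fundamental_theorem_of_calculus)
      fix z assume z: "z \<in> {x..y}"
      have "((\<lambda>z. w z / sin (z - a)) has_real_derivative g z * (1 / sin (z - a))) (at z)"
        using nz[OF z]
        by (auto intro!: derivative_eq_intros w simp: g_def cot_def field_simps)
      then show "((\<lambda>z. w z / sin (z - a)) has_vector_derivative g z * (1 / sin (z - a))) (at z within {x..y})"
        by (simp add: has_field_derivative_at_within flip: has_real_derivative_iff_has_vector_derivative)
    qed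
    have i: "((\<lambda>z. (1 / sin (z - a))\<^sup>2) has_integral (- cot (y - a)) - (- cot (x - a))) {x..y}"
      using \<open>x \<le> y\<close>
    proof (rule fundamental_theorem_of_calculus)
      fix z assume z: "z \<in> {x..y}"
      have "((\<lambda>z. - cot (z - a)) has_real_derivative (1 / sin (z - a))\<^sup>2) (at z)"
        using nz[OF z]
        by (auto intro!: derivative_eq_intros DERIV_cot[THEN DERIV_chain2] simp: field_simps)
      then show "((\<lambda>z. - cot (z - a)) has_vector_derivative (1 / sin (z - a))\<^sup>2) (at z within {x..y})"
        by (simp add: has_field_derivative_at_within flip: has_real_derivative_iff_has_vector_derivative)
    qed
    have "integral {x..y} (\<lambda>z. (g z)\<^sup>2) \<le> integral {a..b} (\<lambda>z. (g z)\<^sup>2)"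
    proof (rule integral_subset_le)
      show "(\<lambda>z. (g z)\<^sup>2) integrable_on {a..b}" using gE by blast
    qed (use that in \<open>auto intro!: integrable_continuous_interval continuous_intros cg\<close>)
    also have "\<dots> = E" using gE by (rule integral_unique)
    finally have *: "integral {x..y} (\<lambda>z. (g z)\<^sup>2) \<le> E" .
    have "(w y / sin (y - a) - w x / sin (x - a))\<^sup>2
        \<le> integral {x..y} (\<lambda>z. (g z)\<^sup>2) * (cot (x - a) - cot (y - a))"
      using Cauchy_Schwarz_integral[OF cg ci] integral_unique[OF k] integral_unique[OF i] by simp
    also have "\<dots> \<le> E * (cot (x - a) - cot (y - a))"
      using has_integral_nonneg[OF i] by (intro mult_right_mono *) auto
    finally show ?thesis .
  qed
  \<comment> \<open>Comparing with the midpoint, where cot vanishes, bounds the oscillation of k by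
    E |cot|. The factor sin^2 tames the pole, leaving E sin |cos| <= E; integration over length pi
    gives the constant of the claim.\<close>
  have pt: "(w x - w c * sin (x - a))\<^sup>2 \<le> E" if "x \<in> {a..b}" for x
  proof (cases "x = a \<or> x = b")
    case True
    then have "w x = 0" "sin (x - a) = 0" using assms by (auto simp: b_def)
    then show ?thesis using \<open>E \<ge> 0\<close> by simp
  next
    case False
    then have x: "a < x" "x < b" using that by auto
    have c: "a < c" "c < b" "sin (c - a) = 1" "cot (c - a) = 0"
      using pi_gt_zero by (auto simp: c_def b_def cot_def)
    define S where "S = sin (x - a)"
    have S: "S > 0" "S \<le> 1" using sin_pos[OF x] by (auto simp: S_def)
    have "(w x / S - w c)\<^sup>2 \<le> E * \<bar>cot (x - a)\<bar>"
    proof (cases "x \<le> c")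
      case True
      have "(w c / sin (c - a) - w x / S)\<^sup>2 \<le> E * (cot (x - a) - cot (c - a))"
        unfolding S_def using x c True by (intro osc)
      also have "\<dots> \<le> E * \<bar>cot (x - a)\<bar>" using c \<open>E \<ge> 0\<close> by (intro mult_left_mono) auto
      finally show ?thesis using c by (simp add: power2_commute)
    next
      case False
      have "(w x / S - w c / sin (c - a))\<^sup>2 \<le> E * (cot (c - a) - cot (x - a))"
        unfolding S_def using x c False by (intro osc) auto
      also have "\<dots> \<le> E * \<bar>cot (x - a)\<bar>" using c \<open>E \<ge> 0\<close> by (intro mult_left_mono) auto
      finally show ?thesis using c by simp
    qed
    then have "S\<^sup>2 * (w x / S - w c)\<^sup>2 \<le> S\<^sup>2 * (E * \<bar>cot (x - a)\<bar>)"
      by (intro mult_left_mono) auto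
    also have "\<dots> = E * (S * \<bar>cos (x - a)\<bar>)"
      using S by (simp add: cot_def S_def[symmetric] power2_eq_square abs_divide)
    also have "\<dots> \<le> E * (1 * 1)"
      using S \<open>E \<ge> 0\<close> by (intro mult_left_mono mult_mono) auto
    also have "S\<^sup>2 * (w x / S - w c)\<^sup>2 = (w x - w c * S)\<^sup>2"
      using S by (simp add: power2_eq_square algebra_simps)
    finally show ?thesis by (simp add: S_def)
  qed
  have "integral {a..b} (\<lambda>x. (w x - w c * sin (x - a))\<^sup>2) \<le> integral {a..b} (\<lambda>x. E)"
    by (intro integral_le pt integrable_continuous_interval continuous_intros cw)
  then show ?thesis by (simp add: b_def c_def E_def)
qed

text \<open>Shows that the first Fourier coefficient of Wirtinger's extremal points to the midpoint
  of its half circle. In the product-to-sum formula one term has period pi and integrates to 0, the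
  other is constant.\<close>

lemma integral_sin_cos_half_period:
  "integral {a..a+pi} (\<lambda>x. sin (x - a) * cos (x - b)) = pi/2 * cos (a + pi/2 - b)"
proof -
  have "((\<lambda>x. sin (x - a) * cos (x - b)) has_integral
      (- cos (2 * (a + pi) - a - b) / 4 + (a + pi) * sin (b - a) / 2)
      - (- cos (2 * a - a - b) / 4 + a * sin (b - a) / 2)) {a..a+pi}"
  proof (rule fundamental_theorem_of_calculus)
    fix x
    have "((\<lambda>x. - cos (2 * x - a - b) / 4 + x * sin (b - a) / 2) has_real_derivative
        sin (2 * x - a - b) / 2 + sin (b - a) / 2) (at x)"
      by (auto intro!: derivative_eq_intros)
    moreover have "sin (2 * x - a - b) / 2 + sin (b - a) / 2 = sin (x - a) * cos (x - b)"
    proof -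
      have "2 * x - a - b = (x - a) + (x - b)" "b - a = (x - a) - (x - b)" by simp_all
      then have "sin (2 * x - a - b) = sin (x - a) * cos (x - b) + cos (x - a) * sin (x - b)"
        "sin (b - a) = sin (x - a) * cos (x - b) - cos (x - a) * sin (x - b)"
        by (metis sin_add, metis sin_diff)
      then show ?thesis by linarith
    qed
    ultimately show "((\<lambda>x. - cos (2 * x - a - b) / 4 + x * sin (b - a) / 2)
        has_vector_derivative sin (x - a) * cos (x - b)) (at x within {a..a+pi})"
      by (simp add: has_field_derivative_at_within flip: has_real_derivative_iff_has_vector_derivative)
  qed simp
  moreover have "cos (2 * (a + pi) - a - b) = cos (2 * a - a - b)"
    using cos_periodic[of "2 * a - a - b"] by (simp add: algebra_simps)
  moreover have "cos (a + pi/2 - b) = sin (b - a)"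
    using cos_sin_eq[of "a + pi/2 - b"] by simp
  ultimately show ?thesis by (simp add: integral_unique algebra_simps)
qed

section \<open>Increments and growth of real functions\<close>

lemma nondecreasing_if_deriv_nonneg:
  fixes f f' :: "real \<Rightarrow> real"
  assumes "a \<le> b"
    and "\<And>x. a \<le> x \<Longrightarrow> x \<le> b \<Longrightarrow> (f has_real_derivative f' x) (at x)"
    and "\<And>x. a \<le> x \<Longrightarrow> x \<le> b \<Longrightarrow> f' x \<ge> 0"
  shows "f a \<le> f b"
  using assms by (intro DERIV_nonneg_imp_nondecreasing[of a b f]) blast+

text \<open>Cauchy-Schwarz for the increment of g, in a form that asks for no integrability of the
  derivatives: with the mean slope \<open>l\<close>, L p' - 2 l g' + l^2 >= (g' - l)^2 >= 0, so a
  primitive of the left side is nondecreasing.\<close>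

lemma increment_bound:
  fixes g p g' p' :: "real \<Rightarrow> real"
  assumes "a < b"
    and g: "\<And>x. a \<le> x \<Longrightarrow> x \<le> b \<Longrightarrow> (g has_real_derivative g' x) (at x)"
    and p: "\<And>x. a \<le> x \<Longrightarrow> x \<le> b \<Longrightarrow> (p has_real_derivative p' x) (at x)"
    and le: "\<And>x. a \<le> x \<Longrightarrow> x \<le> b \<Longrightarrow> (g' x)\<^sup>2 \<le> L * p' x"
  shows "(g b - g a)\<^sup>2 \<le> L * (b - a) * (p b - p a)"
proof -
  define l where "l = (g b - g a) / (b - a)"
  have l: "l * (b - a) = g b - g a" using \<open>a < b\<close> by (simp add: l_def)
  have "L * p a - 2 * l * g a + l\<^sup>2 * a \<le> L * p b - 2 * l * g b + l\<^sup>2 * b"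
  proof (rule DERIV_nonneg_imp_nondecreasing[of a b "\<lambda>x. L * p x - 2 * l * g x + l\<^sup>2 * x"])
    fix x assume x: "a \<le> x" "x \<le> b"
    have "((\<lambda>x. L * p x - 2 * l * g x + l\<^sup>2 * x) has_real_derivative
        L * p' x - 2 * l * g' x + l\<^sup>2) (at x)"
      by (auto intro!: derivative_eq_intros g p x)
    moreover have "L * p' x - 2 * l * g' x + l\<^sup>2 \<ge> 0"
    proof -
      have "0 \<le> (g' x - l)\<^sup>2" by simp
      then show ?thesis using le[OF x] by (simp add: power2_eq_square algebra_simps)
    qed
    ultimately show "\<exists>y. ((\<lambda>x. L * p x - 2 * l * g x + l\<^sup>2 * x) has_real_derivative y) (at x) \<and> 0 \<le> y"
      by blast
  qed (use \<open>a < b\<close> in simp)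
  then have "0 \<le> L * (p b - p a) - 2 * l * (g b - g a) + l * (l * (b - a))"
    by (simp add: algebra_simps power2_eq_square)
  then have "l * (g b - g a) \<le> L * (p b - p a)" unfolding l by simp
  then have "l * (b - a) * (g b - g a) \<le> L * (b - a) * (p b - p a)"
    using mult_right_mono[of _ _ "b - a"] \<open>a < b\<close> by (fastforce simp: mult_ac)
  then show ?thesis unfolding l by (simp add: power2_eq_square)
qed

text \<open>Increments that are square-summable add up to \<open>o(\<surd>n)\<close>, by Cauchy--Schwarz.\<close>

lemma eventually_less_sqrt:
  fixes S :: "real \<Rightarrow> real" and D a :: "nat \<Rightarrow> real"
  assumes "mono S" and D: "\<And>k. D k \<ge> 0" "summable D"
    and a: "\<And>k. real k \<le> a k"
    and inc: "\<And>k. k \<ge> k0 \<Longrightarrow> S (a (Suc k)) - S (a k) \<le> C * sqrt (D k + D (Suc k))"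
    and "C \<ge> 0" "c > 0"
  shows "\<forall>\<^sub>F t in at_top. S t < c * sqrt t"
proof -
  define e where "e = (\<lambda>k. D k + D (Suc k))"
  have e: "e k \<ge> 0" for k using D by (simp add: e_def)
  have "summable e" unfolding e_def
    using D(2) by (intro summable_add) (simp_all add: summable_Suc_iff)
  \<comment> \<open>This makes \<open>C\<close> r <= c/4. Since n <= t + 1 <= 4 t below, the sum
    costs at most half of c sqrt t, and the other half absorbs the constant \<open>S (a m)\<close>.
    The summand 1 covers \<open>C\<close> = 0.\<close>
  define r where "r = c / (4 * (C + 1))"
  have "r > 0" using assms by (simp add: r_def)
  then have "r\<^sup>2 > 0" by simp
  with \<open>summable e\<close> obtain m0 where m0: "\<And>m n. m \<ge> m0 \<Longrightarrow> norm (sum e {m..<n}) < r\<^sup>2"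
    unfolding summable_Cauchy by blast
  define m where "m = max m0 k0"
  have step: "S (a n) \<le> S (a m) + c/4 * sqrt n" if "n \<ge> m" for n
  proof -
    have "(\<Sum>k=m..<n. sqrt (e k) * 1)\<^sup>2 \<le> (\<Sum>k=m..<n. (sqrt (e k))\<^sup>2) * (\<Sum>k=m..<n. 1\<^sup>2)"
      by (rule Cauchy_Schwarz_ineq_sum)
    also have "\<dots> = (\<Sum>k=m..<n. e k) * real (n - m)" using e by simp
    also have "\<dots> \<le> r\<^sup>2 * real n"
      using m0[of m n] by (intro mult_mono) (auto simp: m_def)
    finally have "(\<Sum>k=m..<n. sqrt (e k)) \<le> sqrt (r\<^sup>2 * real n)"
      by (intro real_le_rsqrt) simp
    also have "\<dots> = r * sqrt n" using \<open>r > 0\<close> by (simp add: real_sqrt_mult)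
    finally have "(\<Sum>k=m..<n. sqrt (e k)) \<le> r * sqrt n" .
    then have "C * (\<Sum>k=m..<n. sqrt (e k)) \<le> C * (r * sqrt n)"
      using \<open>C \<ge> 0\<close> by (rule mult_left_mono)
    moreover have "C * r \<le> c/4" using assms by (simp add: r_def field_simps)
    then have "C * r * sqrt n \<le> c/4 * sqrt n" by (rule mult_right_mono) simp
    moreover have "S (a n) - S (a m) = (\<Sum>k=m..<n. S (a (Suc k)) - S (a k))"
      using that sum_Suc_diff'[of m n "\<lambda>k. S (a k)"] by simp
    moreover have "\<dots> \<le> (\<Sum>k=m..<n. C * sqrt (e k))"
      using inc by (intro sum_mono) (auto simp: e_def m_def)
    ultimately show ?thesis by (simp add: sum_distrib_left mult.assoc)
  qed
  have "filterlim (\<lambda>t. c/2 * sqrt t) at_top at_top"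
    using \<open>c > 0\<close> by (intro filterlim_tendsto_pos_mult_at_top[OF tendsto_const] sqrt_at_top) auto
  then have "\<forall>\<^sub>F t in at_top. c/2 * sqrt t > S (a m)"
    by (simp add: filterlim_at_top_dense)
  then show ?thesis
    using eventually_ge_at_top[of "real m + 1"]
  proof eventually_elim
    case (elim t)
    define n where "n = nat \<lceil>t\<rceil>"
    have "real n = of_int \<lceil>t\<rceil>" using elim by (simp add: n_def)
    then have n: "real n \<ge> t" "real n \<le> t + 1" by linarith+
    then have "n \<ge> m" using elim by linarith
    have "sqrt n \<le> sqrt (2\<^sup>2 * t)" using n elim by (intro real_sqrt_le_mono) simp
    also have "\<dots> = 2 * sqrt t" by (simp only: real_sqrt_mult real_sqrt_abs abs_numeral)
    finally have "c/4 * sqrt n \<le> c/4 * (2 * sqrt t)" using \<open>c > 0\<close> by simp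
    moreover have "S t \<le> S (a n)" using \<open>mono S\<close> n a[of n] by (intro monoD[of S]) auto
    moreover have "S (a n) \<le> S (a m) + c/4 * sqrt n" by (rule step) fact
    ultimately show ?case using elim by simp
  qed
qed

lemma has_real_derivative_integral_param:
  fixes f f' :: "real \<Rightarrow> real \<Rightarrow> real"
  assumes "\<And>t x. ((\<lambda>t. f t x) has_real_derivative f' t x) (at t)"
    and "continuous_on UNIV (\<lambda>(t, x). f' t x)" and "\<And>t. continuous_on UNIV (f t)"
  shows "((\<lambda>t. integral {a..b} (f t)) has_real_derivative integral {a..b} (f' t)) (at t)"
proof -
  have "((\<lambda>t. integral (cbox a b) (f t)) has_real_derivative integral (cbox a b) (f' t)) (at t within UNIV)"
  proof (rule leibniz_rule_field_derivative)
    show "f t integrable_on cbox a b" for t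
      using assms(3)[of t] continuous_on_subset by (intro integrable_continuous) blast
    show "continuous_on (UNIV \<times> cbox a b) (\<lambda>(t, x). f' t x)"
      using assms(2) by (rule continuous_on_subset) simp
  qed (use assms in auto)
  then show ?thesis by simp
qed

text \<open>Jordan's inequality, by concavity of sin.\<close>

lemma sin_ge_chord:
  fixes x :: real
  assumes "0 \<le> x" "x \<le> pi/2"
  shows "2 * x / pi \<le> sin x"
proof -
  have "convex_on {0..pi} (\<lambda>x. - sin x :: real)"
  proof (rule f''_ge0_imp_convex)
    show "((\<lambda>x. - sin x) has_real_derivative - cos x) (at x)"
      "((\<lambda>x. - cos x) has_real_derivative sin x) (at x)" for x :: real
      by (auto intro!: derivative_eq_intros)
  qed (auto intro: sin_ge_zero)
  then have "- sin ((1 - 2 * x / pi) *\<^sub>R 0 + (2 * x / pi) *\<^sub>R (pi/2))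
      \<le> (1 - 2 * x / pi) * (- sin 0) + (2 * x / pi) * (- sin (pi/2))"
    using assms by (intro convex_onD) auto
  then show ?thesis by simp
qed

subsection \<open>Carleman's method in a rotating strip\<close>

text \<open>Logarithmic coordinates: \<open>(t, h)\<close> stands for the point \<open>exp (t + \<i> h)\<close>, so that
  \<open>S t = s (exp t)\<close>.\<close>

locale rotating_strip =
  fixes u ut uh utt uhh :: "real \<Rightarrow> real \<Rightarrow> real" and S :: "real \<Rightarrow> real" and C :: real
  assumes u_t: "\<And>t h. ((\<lambda>t. u t h) has_real_derivative ut t h) (at t)"
    and u_h: "\<And>t h. ((\<lambda>h. u t h) has_real_derivative uh t h) (at h)"
    and u_tt: "\<And>t h. ((\<lambda>t. ut t h) has_real_derivative utt t h) (at t)"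
    and u_hh: "\<And>t h. ((\<lambda>h. uh t h) has_real_derivative uhh t h) (at h)"
    and cont_u: "continuous_on UNIV (\<lambda>(t, h). u t h)"
    and cont_ut: "continuous_on UNIV (\<lambda>(t, h). ut t h)"
    and cont_utt: "continuous_on UNIV (\<lambda>(t, h). utt t h)"
    and cont_uhh: "continuous_on UNIV (\<lambda>(t, h). uhh t h)"
    and u_periodic: "\<And>t h. u t (h + 2 * pi) = u t h"
    and uh_periodic: "\<And>t h. uh t (h + 2 * pi) = uh t h"
    and u_nonneg: "\<And>t h. u t h \<ge> 0"
    and subharmonic: "\<And>t h. utt t h + uhh t h \<ge> 0"
    and u_zero: "\<And>t h. S t \<le> h \<Longrightarrow> h \<le> S t + pi \<Longrightarrow> u t h = 0"
    and growth: "\<And>t h. u t h \<le> C * (1 + exp t)"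
    and mono_S: "mono S"
    and cont_S: "continuous_on UNIV S"
begin

lemma cont_slice:
  "continuous_on A (u t)" "continuous_on A (ut t)" "continuous_on A (utt t)" "continuous_on A (uhh t)"
  "continuous_on A (uh t)"
proof -
  have *: "continuous_on A (f t)" if "continuous_on UNIV (\<lambda>(t, h). f t h)" for f :: "real \<Rightarrow> real \<Rightarrow> real"
    using continuous_on_compose2[OF that, of A "\<lambda>h. (t, h)"] by (simp add: continuous_on_Pair)
  show "continuous_on A (u t)" "continuous_on A (ut t)" "continuous_on A (utt t)" "continuous_on A (uhh t)"
    by (intro * cont_u cont_ut cont_utt cont_uhh)+
  show "continuous_on A (uh t)"
    using DERIV_isCont[OF u_hh] by (intro continuous_at_imp_continuous_on) blast
qed

abbreviation circ :: "(real \<Rightarrow> real) \<Rightarrow> real" where "circ \<equiv> integral {0..2*pi}"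

text \<open>Primed names hold formulas for t-derivatives, proved to be such further down; those
  built from \<open>N\<close> are derivatives only where \<open>I t > 0\<close>.\<close>

definition "I t = circ (\<lambda>h. (u t h)\<^sup>2)"
definition "I' t = circ (\<lambda>h. 2 * u t h * ut t h)"
definition "I'' t = circ (\<lambda>h. 2 * (ut t h)\<^sup>2 + 2 * u t h * utt t h)"
definition "A t = circ (\<lambda>h. (ut t h)\<^sup>2)"
definition "B t = circ (\<lambda>h. (uh t h)\<^sup>2)"
definition "N t = sqrt (I t)"
definition "N' t = I' t / (2 * N t)"
definition "N'' t = I'' t / (2 * N t) - (I' t)\<^sup>2 / (4 * I t * N t)"
text \<open>With \<open>\<omega> = u / N\<close>, the quantity \<open>q\<close> is
  \<open>(\<parallel>\<omega>\<^sub>h\<parallel>\<^sup>2 - 1) + \<parallel>\<omega>\<^sub>t\<parallel>\<^sup>2\<close> in \<open>L\<^sup>2\<close> of the circle; the two summands are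
  \<open>q1\<close> and \<open>q2\<close> below.\<close>

definition "q t = (A t + B t) / I t - (I' t)\<^sup>2 / (4 * (I t)\<^sup>2) - 1"
text \<open>Chosen so that differentiation produces N'' - N without a first-order term.\<close>

definition "p t = (N' t + N t) * exp (- t)"
definition "p' t = (N'' t - N t) * exp (- t)"
definition "X b t = circ (\<lambda>h. u t h * cos (h - b))"
definition "X' b t = circ (\<lambda>h. ut t h * cos (h - b))"
definition "G b t = X b t / N t"
definition "G' b t = X' b t / N t - X b t * N' t / I t"
text \<open>Midpoint of the half circle from \<open>S t - pi\<close> to \<open>S t\<close>, outside
  of which u vanishes.\<close>

definition "M t = S t - pi/2"

section \<open>Differential inequality for the L^2 norm on circles\<close>

lemma I_nonneg: "I t \<ge> 0" unfolding I_def by (intro integral_nonneg integrable_continuous_interval continuous_intros cont_slice) auto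

lemma I_deriv: "(I has_real_derivative I' t) (at t)"
  unfolding I_def[abs_def] I'_def
proof (rule has_real_derivative_integral_param)
  show "((\<lambda>t. (u t x)\<^sup>2) has_real_derivative 2 * u t x * ut t x) (at t)" for t x
    by (auto intro!: derivative_eq_intros u_t)
  show "continuous_on UNIV (\<lambda>(t, x). 2 * u t x * ut t x)"
    using cont_u cont_ut unfolding split_beta by (intro continuous_intros) auto
qed (intro continuous_intros cont_slice)

lemma I'_deriv: "(I' has_real_derivative I'' t) (at t)"
  unfolding I'_def[abs_def] I''_def
proof (rule has_real_derivative_integral_param)
  show "((\<lambda>t. 2 * u t x * ut t x) has_real_derivative 2 * (ut t x)\<^sup>2 + 2 * u t x * utt t x) (at t)" for t x
    by (auto intro!: derivative_eq_intros u_t u_tt simp: power2_eq_square)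
  show "continuous_on UNIV (\<lambda>(t, x). 2 * (ut t x)\<^sup>2 + 2 * u t x * utt t x)"
    using cont_u cont_ut cont_utt unfolding split_beta by (intro continuous_intros) auto
qed (intro continuous_intros cont_slice)

lemma X_deriv: "(X b has_real_derivative X' b t) (at t)"
  unfolding X_def[abs_def] X'_def
proof (rule has_real_derivative_integral_param)
  show "((\<lambda>t. u t x * cos (x - b)) has_real_derivative ut t x * cos (x - b)) (at t)" for t x
    by (auto intro!: derivative_eq_intros u_t)
  show "continuous_on UNIV (\<lambda>(t, x). ut t x * cos (x - b))"
    using cont_ut unfolding split_beta by (intro continuous_intros) auto
qed (intro continuous_intros cont_slice)

text \<open>Subharmonicity times u >= 0 gives u u_tt >= - u u_hh, and integration by parts on the
  circle turns the integral of - u u_hh into \<open>B t\<close>.\<close>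

lemma I''_ge: "I'' t \<ge> 2 * A t + 2 * B t"
proof -
  have "((\<lambda>h. (uh t h)\<^sup>2 + u t h * uhh t h) has_integral u t (2*pi) * uh t (2*pi) - u t 0 * uh t 0) {0..2*pi}"
  proof (rule fundamental_theorem_of_calculus)
    fix h
    have "((\<lambda>h. u t h * uh t h) has_real_derivative (uh t h)\<^sup>2 + u t h * uhh t h) (at h)"
      by (auto intro!: derivative_eq_intros u_h u_hh simp: power2_eq_square)
    then show "((\<lambda>h. u t h * uh t h) has_vector_derivative (uh t h)\<^sup>2 + u t h * uhh t h) (at h within {0..2*pi})"
      by (simp add: has_field_derivative_at_within flip: has_real_derivative_iff_has_vector_derivative)
  qed simp
  then have parts: "((\<lambda>h. (uh t h)\<^sup>2 + u t h * uhh t h) has_integral 0) {0..2*pi}"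
    using u_periodic[of t 0] uh_periodic[of t 0] by simp
  have "((\<lambda>h. 2 * (ut t h)\<^sup>2 + 2 * (uh t h)\<^sup>2 - 2 * ((uh t h)\<^sup>2 + u t h * uhh t h))
      has_integral 2 * A t + 2 * B t - 2 * 0) {0..2*pi}"
    unfolding A_def B_def
    by (intro has_integral_diff has_integral_add has_integral_mult_right parts
          integrable_integral integrable_continuous_interval continuous_intros cont_slice)
  then have h: "((\<lambda>h. 2 * (ut t h)\<^sup>2 + 2 * (uh t h)\<^sup>2 - 2 * ((uh t h)\<^sup>2 + u t h * uhh t h))
      has_integral 2 * A t + 2 * B t) {0..2*pi}" by simp
  have "2 * A t + 2 * B t = circ (\<lambda>h. 2 * (ut t h)\<^sup>2 + 2 * (uh t h)\<^sup>2 - 2 * ((uh t h)\<^sup>2 + u t h * uhh t h))"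
    using h by (simp add: integral_unique)
  also have "\<dots> \<le> I'' t" unfolding I''_def
  proof (rule integral_le)
    show "(\<lambda>h. 2 * (ut t h)\<^sup>2 + 2 * (uh t h)\<^sup>2 - 2 * ((uh t h)\<^sup>2 + u t h * uhh t h)) integrable_on {0..2*pi}"
      using h by blast
    show "(\<lambda>h. 2 * (ut t h)\<^sup>2 + 2 * u t h * utt t h) integrable_on {0..2*pi}"
      by (intro integrable_continuous_interval continuous_intros cont_slice)
    fix h
    have "0 \<le> u t h * (utt t h + uhh t h)" by (intro mult_nonneg_nonneg u_nonneg subharmonic)
    then show "2 * (ut t h)\<^sup>2 + 2 * (uh t h)\<^sup>2 - 2 * ((uh t h)\<^sup>2 + u t h * uhh t h)
        \<le> 2 * (ut t h)\<^sup>2 + 2 * u t h * utt t h"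
      by (simp add: algebra_simps)
  qed
  finally show ?thesis .
qed

lemma AB_nonneg: "A t \<ge> 0" "B t \<ge> 0"
  unfolding A_def B_def by (intro integral_nonneg integrable_continuous_interval continuous_intros cont_slice; simp)+

lemma I_le: "I t \<le> 2 * pi * (C * (1 + exp t))\<^sup>2"
proof -
  have "I t \<le> circ (\<lambda>h. (C * (1 + exp t))\<^sup>2)"
    unfolding I_def
    by (intro integral_le integrable_continuous_interval continuous_intros cont_slice power_mono growth u_nonneg)
  then show ?thesis by simp
qed

lemma C_nonneg: "C \<ge> 0"
proof -
  have "0 \<le> C * (1 + exp 0)" using u_nonneg growth order_trans by blast
  then show ?thesis by simp
qed

text \<open>A convex function on the line that is bounded near \<open>-\<infinity>\<close> is nondecreasing.\<close>

lemma I'_nonneg: "I' t \<ge> 0"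
proof (rule ccontr)
  assume "\<not> I' t \<ge> 0"
  then have neg: "I' t < 0" by simp
  have I'_mono: "I' x \<le> I' t" if "x \<le> t" for x
  proof (rule DERIV_nonneg_imp_nondecreasing[OF that])
    fix y
    show "\<exists>z. (I' has_real_derivative z) (at y) \<and> 0 \<le> z"
      using I'_deriv[of y] I''_ge[of y] AB_nonneg[of y] by (intro exI[of _ "I'' y"]) auto
  qed
  define K where "K = 2 * pi * (C * (1 + exp 0))\<^sup>2"
  have K: "I x \<le> K" if "x \<le> 0" for x
  proof -
    have "(C * (1 + exp x))\<^sup>2 \<le> (C * (1 + exp 0))\<^sup>2"
      using that C_nonneg by (intro power_mono mult_left_mono) auto
    then show ?thesis using I_le[of x] unfolding K_def
      by (meson mult_left_mono order_trans pi_ge_zero zero_le_mult_iff zero_le_numeral)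
  qed
  \<comment> \<open>So far to the left that the tangent of the convex function \<open>I\<close> at t
    rises above \<open>I t + K\<close> there, although \<open>I\<close> <= \<open>K\<close> on the
    negative axis.\<close>
  define x where "x = min (min t 0 - 1) (t - (K + 1) / (- I' t))"
  have "x < t" "x \<le> 0" by (auto simp: x_def)
  obtain z where z: "z < t" "I t - I x = (t - x) * I' z"
    using MVT2[OF \<open>x < t\<close>, of I I'] I_deriv by blast
  have "(t - x) * I' z \<le> (t - x) * I' t"
    using \<open>x < t\<close> I'_mono[of z] z by (intro mult_left_mono) auto
  moreover have "(t - x) * (- I' t) \<ge> K + 1"
  proof -
    have "t - x \<ge> (K + 1) / (- I' t)" by (simp add: x_def)
    then show ?thesis using neg by (metis neg_0_less_iff_less pos_divide_le_eq)
  qed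
  ultimately have "I x \<ge> I t + K + 1" using z by simp
  with K[OF \<open>x \<le> 0\<close>] I_nonneg[of t] show False by simp
qed

text \<open>Positivity of \<open>I\<close> at one point therefore persists to the right of it, where
  \<open>N\<close> can be differentiated.\<close>

lemma I_mono: "x \<le> y \<Longrightarrow> I x \<le> I y"
  using I_deriv I'_nonneg by (intro DERIV_nonneg_imp_nondecreasing[of x y I]) blast+

lemma N_deriv: "I t > 0 \<Longrightarrow> (N has_real_derivative N' t) (at t)"
  unfolding N_def[abs_def] N'_def
  by (auto intro!: derivative_eq_intros I_deriv simp: field_simps)

lemma N_pos: "I t > 0 \<Longrightarrow> N t > 0" by (simp add: N_def)
lemma N_sq: "(N t)\<^sup>2 = I t" using I_nonneg by (simp add: N_def)

lemma N'_deriv: assumes "I t > 0" shows "(N' has_real_derivative N'' t) (at t)"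
proof -
  have "((\<lambda>t. I' t / (2 * N t)) has_real_derivative (I'' t * (2 * N t) - I' t * (2 * N' t)) / (2 * N t)\<^sup>2) (at t)"
    using N_pos[OF assms] by (auto intro!: derivative_eq_intros I'_deriv N_deriv assms simp: power2_eq_square)
  moreover have "(I'' t * (2 * N t) - I' t * (2 * N' t)) / (2 * N t)\<^sup>2 = N'' t"
    unfolding N''_def N'_def N_sq[symmetric] using N_pos[OF assms]
    by (simp add: field_simps power2_eq_square)
  ultimately show ?thesis by (simp add: N'_def[abs_def])
qed

lemma p_deriv: assumes "I t > 0" shows "(p has_real_derivative p' t) (at t)"
  unfolding p_def[abs_def] p'_def
  by (auto intro!: derivative_eq_intros N_deriv N'_deriv assms simp: algebra_simps)

text \<open>\<open>I''_ge\<close> is inserted into \<open>N''\<close>; \<open>q\<close> is defined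
  so that N q + N is exactly the resulting lower bound.\<close>

lemma p'_ge: assumes "I t > 0" shows "p' t \<ge> N t * exp (- t) * q t"
proof -
  have "N t > 0" using N_pos assms .
  have "N t * q t = (2 * A t + 2 * B t) / (2 * N t) - (I' t)\<^sup>2 / (4 * I t * N t) - N t"
    unfolding q_def N_sq[symmetric] using \<open>N t > 0\<close>
    by (simp add: field_simps power2_eq_square)
  also have "\<dots> \<le> N'' t - N t"
    unfolding N''_def using I''_ge[of t] \<open>N t > 0\<close> by (simp add: divide_right_mono)
  finally have "N t * q t * exp (- t) \<le> (N'' t - N t) * exp (- t)"
    by (rule mult_right_mono) simp
  then show ?thesis by (simp add: p'_def mult_ac)
qed

section \<open>Wirtinger's deficit on the half circle that carries u\<close>

lemma circ_strip:
  assumes g: "continuous_on UNIV g" and per: "\<And>h. g (h + 2 * pi) = g h"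
    and 0: "\<And>h. S t \<le> h \<Longrightarrow> h \<le> S t + pi \<Longrightarrow> g h = 0"
  shows "circ g = integral {S t - pi..S t - pi + pi} g"
proof -
  \<comment> \<open>The window of length 2 pi is centred at \<open>S t\<close>, so its right half is
    the strip of zeros. The end point \<open>S t - pi + pi\<close> keeps the shape
    \<open>{a..a+pi}\<close> of \<open>Wirtinger_deficit\<close>.\<close>
  have "circ g = integral {S t - pi..S t - pi + 2 * pi} g"
    using integral_periodic[OF g per, of "S t - pi"] by simp
  also have "\<dots> = integral {S t - pi..S t} g + integral {S t..S t - pi + 2 * pi} g"
    using continuous_on_subset[OF g]
    by (intro Henstock_Kurzweil_Integration.integral_combine[symmetric] integrable_continuous_interval) auto
  also have "integral {S t..S t - pi + 2 * pi} g = integral {S t..S t - pi + 2 * pi} (\<lambda>_. 0)"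
    by (intro integral_cong 0) auto
  finally show ?thesis by simp
qed

definition "q1 t = B t / I t - 1"
definition "q2 t = A t / I t - (I' t)\<^sup>2 / (4 * (I t)\<^sup>2)"

lemma q_split: "q t = q1 t + q2 t" by (simp add: q_def q1_def q2_def add_divide_distrib)

lemma I_strip: "I t = integral {S t - pi..S t - pi + pi} (\<lambda>h. (u t h)\<^sup>2)"
  unfolding I_def by (rule circ_strip) (auto intro!: continuous_intros cont_slice simp: u_periodic u_zero)

lemma X_strip: "X b t = integral {S t - pi..S t - pi + pi} (\<lambda>h. u t h * cos (h - b))"
  unfolding X_def
proof (rule circ_strip)
  have "cos (h + 2 * pi - b) = cos (h - b)" for h
    using cos_periodic[of "h - b"] by (simp add: algebra_simps)
  then show "u t (h + 2 * pi) * cos (h + 2 * pi - b) = u t h * cos (h - b)" for h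
    by (simp add: u_periodic)
qed (auto intro!: continuous_intros cont_slice simp: u_zero)

lemma B_strip: "integral {S t - pi..S t - pi + pi} (\<lambda>h. (uh t h)\<^sup>2) \<le> B t"
proof -
  have "B t = integral {S t - pi..S t - pi + 2 * pi} (\<lambda>h. (uh t h)\<^sup>2)"
    unfolding B_def using uh_periodic
    by (intro integral_periodic[symmetric] continuous_intros cont_slice) auto
  also have "\<dots> \<ge> integral {S t - pi..S t - pi + pi} (\<lambda>h. (uh t h)\<^sup>2)"
    by (intro integral_subset_le integrable_continuous_interval continuous_intros cont_slice) auto
  finally show ?thesis .
qed

lemma deficit:
  assumes "I t > 0"
  shows "integral {S t - pi..S t - pi + pi} (\<lambda>h. (u t h - u t (M t) * sin (h - (S t - pi)))\<^sup>2)
    \<le> pi * (q1 t * I t)"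
proof -
  have "integral {S t - pi..S t - pi + pi}
      (\<lambda>h. (u t h - u t (S t - pi + pi/2) * sin (h - (S t - pi)))\<^sup>2)
    \<le> pi * (integral {S t - pi..S t - pi + pi} (\<lambda>h. (uh t h)\<^sup>2)
            - integral {S t - pi..S t - pi + pi} (\<lambda>h. (u t h)\<^sup>2))"
    \<comment> \<open>The zero at the left end \<open>S t - pi\<close> is the one at
      \<open>S t + pi\<close>, moved by a period.\<close>
    using u_zero[of t "S t + pi"] u_periodic[of t "S t - pi"]
    by (intro Wirtinger_deficit u_h cont_slice) (auto simp: u_zero algebra_simps)
  also have "\<dots> \<le> pi * (B t - I t)"
    using B_strip[of t] by (intro mult_left_mono) (auto simp: I_strip)
  also have "B t - I t = q1 t * I t" using assms by (simp add: q1_def field_simps)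
  finally show ?thesis by (simp add: M_def algebra_simps)
qed

lemma q1_nonneg: assumes "I t > 0" shows "q1 t \<ge> 0"
proof -
  have "0 \<le> integral {S t - pi..S t - pi + pi} (\<lambda>h. (u t h - u t (M t) * sin (h - (S t - pi)))\<^sup>2)"
    by (intro integral_nonneg integrable_continuous_interval continuous_intros cont_slice) auto
  with deficit[OF assms] have "0 \<le> pi * (q1 t * I t)" by linarith
  then show ?thesis using assms pi_gt_zero by (simp add: zero_le_mult_iff del: pi_gt_zero)
qed

section \<open>First Fourier coefficient and rotation of the half circle\<close>

lemma G_deriv: assumes "I t > 0" shows "(G b has_real_derivative G' b t) (at t)"
proof -
  have "((\<lambda>t. X b t / N t) has_real_derivative (X' b t * N t - X b t * N' t) / (N t * N t)) (at t)"
    using N_pos[OF assms] by (intro DERIV_divide X_deriv N_deriv assms) simp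
  moreover have "(X' b t * N t - X b t * N' t) / (N t * N t) = G' b t"
    unfolding G'_def N_sq[symmetric] using N_pos[OF assms] by (simp add: field_simps power2_eq_square)
  ultimately show ?thesis by (simp add: G_def[abs_def])
qed

lemma circ_cos_sq: "circ (\<lambda>h. (cos (h - b))\<^sup>2) \<le> 2 * pi"
proof -
  have "circ (\<lambda>h. (cos (h - b))\<^sup>2) \<le> circ (\<lambda>h. 1)"
    by (intro integral_le integrable_continuous_interval continuous_intros) (simp add: abs_square_le_1)
  then show ?thesis by simp
qed

text \<open>With omega = u / N, the function \<open>r\<close> is N omega_t, because \<open>l\<close>
  = N' / N. Hence its squared norm is \<open>q2 t * I t\<close>, and \<open>G' b t\<close> is the
  cosine coefficient of omega_t, to which Cauchy-Schwarz applies.\<close>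

lemma q2_bounds:
  assumes "I t > 0" shows "(G' b t)\<^sup>2 \<le> 2 * pi * q2 t" "q2 t \<ge> 0"
proof -
  define l where "l = I' t / (2 * I t)"
  define r where "r = (\<lambda>h. ut t h - l * u t h)"
  have cr: "continuous_on D r" for D unfolding r_def by (intro continuous_intros cont_slice)
  have "((\<lambda>h. (ut t h)\<^sup>2 - l * (2 * u t h * ut t h) + l\<^sup>2 * (u t h)\<^sup>2) has_integral
      A t - l * I' t + l\<^sup>2 * I t) {0..2*pi}"
    unfolding A_def I'_def I_def
    by (intro has_integral_diff has_integral_add has_integral_mult_right
          integrable_integral integrable_continuous_interval continuous_intros cont_slice)
  moreover have "(ut t h)\<^sup>2 - l * (2 * u t h * ut t h) + l\<^sup>2 * (u t h)\<^sup>2 = (r h)\<^sup>2" for h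
    by (simp add: r_def power2_eq_square algebra_simps)
  moreover have "A t - l * I' t + l\<^sup>2 * I t = q2 t * I t"
    using assms by (simp add: q2_def l_def field_simps power2_eq_square)
  ultimately have "((\<lambda>h. (r h)\<^sup>2) has_integral q2 t * I t) {0..2*pi}" by simp
  then have r2: "circ (\<lambda>h. (r h)\<^sup>2) = q2 t * I t" by (rule integral_unique)
  have "circ (\<lambda>h. (r h)\<^sup>2) \<ge> 0"
    by (intro integral_nonneg integrable_continuous_interval continuous_intros cr) auto
  then show "q2 t \<ge> 0" using r2 assms by (simp add: zero_le_mult_iff)
  have "((\<lambda>h. ut t h * cos (h - b) - l * (u t h * cos (h - b))) has_integral X' b t - l * X b t) {0..2*pi}"
    unfolding X'_def X_def
    by (intro has_integral_diff has_integral_mult_right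
          integrable_integral integrable_continuous_interval continuous_intros cont_slice)
  moreover have "ut t h * cos (h - b) - l * (u t h * cos (h - b)) = r h * cos (h - b)" for h
    by (simp add: r_def algebra_simps)
  ultimately have "((\<lambda>h. r h * cos (h - b)) has_integral X' b t - l * X b t) {0..2*pi}" by simp
  moreover have "X' b t - l * X b t = N t * G' b t"
    using N_pos[OF assms] unfolding l_def G'_def N'_def N_sq[symmetric]
    by (simp add: field_simps power2_eq_square)
  ultimately have rc: "circ (\<lambda>h. r h * cos (h - b)) = N t * G' b t"
    by (simp add: integral_unique)
  have "(N t * G' b t)\<^sup>2 \<le> (q2 t * I t) * circ (\<lambda>h. (cos (h - b))\<^sup>2)"
    using Cauchy_Schwarz_integral[OF cr, of 0 "2 * pi" "\<lambda>h. cos (h - b)"] rc r2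
    by (simp add: continuous_intros)
  also have "\<dots> \<le> (q2 t * I t) * (2 * pi)"
    using \<open>q2 t \<ge> 0\<close> assms by (intro mult_left_mono circ_cos_sq) simp
  finally have "I t * (G' b t)\<^sup>2 \<le> I t * (2 * pi * q2 t)"
    by (simp add: power_mult_distrib N_sq mult_ac)
  then show "(G' b t)\<^sup>2 \<le> 2 * pi * q2 t" using assms by simp
qed

lemma q_nonneg: "I t > 0 \<Longrightarrow> q t \<ge> 0"
  using q1_nonneg q2_bounds(2) by (simp add: q_split)

lemma G'_le: "I t > 0 \<Longrightarrow> (G' b t)\<^sup>2 \<le> 2 * pi * q t"
proof -
  assume I: "I t > 0"
  have "(G' b t)\<^sup>2 \<le> 2 * pi * q2 t" by (rule q2_bounds(1)[OF I])
  also have "\<dots> \<le> 2 * pi * q t" using q1_nonneg[OF I] by (simp add: q_split)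
  finally show ?thesis .
qed

text \<open>By \<open>deficit\<close>, u is close to \<open>l\<close> times the extremal, whose
  first Fourier coefficient points to \<open>M t\<close>. Replacing \<open>l\<close> by N / k costs
  a second error of the same size, hence the factor 2.\<close>

lemma G_approx:
  assumes "I t > 0"
  shows "\<bar>G b t - sqrt (pi/2) * cos (M t - b)\<bar> \<le> 2 * pi * sqrt (q t)"
proof -
  define a where "a = S t - pi"
  have Mt: "M t = a + pi/2" by (simp add: M_def a_def)
  define l where "l = u t (M t)"
  define v where "v = (\<lambda>h. u t h - l * sin (h - a))"
  define V where "V = integral {a..a+pi} (\<lambda>h. (v h)\<^sup>2)"
  define e where "e = (\<lambda>b. integral {a..a+pi} (\<lambda>h. v h * cos (h - b)))"
  \<comment> \<open>The L^2 norm of the extremal on its half circle.\<close>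
  define k where "k = sqrt (pi/2)"
  have k: "k > 0" "k\<^sup>2 = pi/2" "k \<le> sqrt pi" by (simp_all add: k_def)
  have "l \<ge> 0" by (simp add: l_def u_nonneg)
  have cv: "continuous_on D v" for D unfolding v_def by (intro continuous_intros cont_slice)
  have "V \<ge> 0" unfolding V_def
    by (intro integral_nonneg integrable_continuous_interval continuous_intros cv) auto
  have "V \<le> pi * (q1 t * I t)" using deficit[OF assms] by (simp add: V_def v_def a_def l_def)
  also have "\<dots> \<le> pi * (q t * I t)"
    using q2_bounds(2)[OF assms] assms by (intro mult_left_mono mult_right_mono) (auto simp: q_split)
  finally have "sqrt V \<le> sqrt (pi * (q t * (N t)\<^sup>2))" by (simp add: N_sq)
  also have "\<dots> = sqrt pi * sqrt (q t) * N t"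
    using N_pos[OF assms] by (simp add: real_sqrt_mult)
  finally have V_le: "sqrt V \<le> sqrt pi * sqrt (q t) * N t" .
  have sin_M: "sin (h - a) = cos (h - M t)" for h
    using sin_cos_eq[of "h - a"] cos_minus[of "h - M t"] by (simp add: Mt algebra_simps)
  have int_sc: "integral {a..a+pi} (\<lambda>h. sin (h - a) * cos (h - b)) = k\<^sup>2 * cos (M t - b)" for b
    using integral_sin_cos_half_period[of a b] by (simp add: k Mt)
  have cos_sq: "integral {a..a+pi} (\<lambda>h. (cos (h - b))\<^sup>2) \<le> pi" for b
  proof -
    have "integral {a..a+pi} (\<lambda>h. (cos (h - b))\<^sup>2) \<le> integral {a..a+pi} (\<lambda>h. 1)"
      by (intro integral_le integrable_continuous_interval continuous_intros) (simp add: abs_square_le_1)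
    then show ?thesis by simp
  qed
  have cos_sq_M: "integral {a..a+pi} (\<lambda>h. (cos (h - M t))\<^sup>2) = k\<^sup>2"
    using int_sc[of "M t"] by (simp add: sin_M power2_eq_square)
  have e_sq: "(e b)\<^sup>2 \<le> V * integral {a..a+pi} (\<lambda>h. (cos (h - b))\<^sup>2)" for b
    unfolding e_def V_def by (intro Cauchy_Schwarz_integral cv continuous_intros)
  have e_le: "\<bar>e b\<bar> \<le> sqrt pi * sqrt V" for b
  proof -
    have "(e b)\<^sup>2 \<le> V * pi" using e_sq cos_sq \<open>V \<ge> 0\<close> mult_left_mono order_trans by blast
    then have "\<bar>e b\<bar> \<le> sqrt (V * pi)" by (intro real_le_rsqrt) simp
    then show ?thesis by (simp add: real_sqrt_mult mult.commute)
  qed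
  have eM: "\<bar>e (M t)\<bar> \<le> k * sqrt V"
  proof -
    have "\<bar>e (M t)\<bar> \<le> sqrt (V * k\<^sup>2)" using e_sq[of "M t"] by (intro real_le_rsqrt) (simp add: cos_sq_M)
    then show ?thesis using k(1) by (simp add: real_sqrt_mult mult.commute)
  qed
  have X_eq: "X b t = l * (k\<^sup>2 * cos (M t - b)) + e b" for b
  proof -
    have "((\<lambda>h. l * (sin (h - a) * cos (h - b)) + v h * cos (h - b)) has_integral
        l * (k\<^sup>2 * cos (M t - b)) + e b) {a..a+pi}"
      unfolding int_sc[symmetric] e_def
      by (intro has_integral_add has_integral_mult_right
          integrable_integral integrable_continuous_interval continuous_intros cv)
    moreover have "l * (sin (h - a) * cos (h - b)) + v h * cos (h - b) = u t h * cos (h - b)" for h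
      by (simp add: v_def algebra_simps)
    ultimately have "((\<lambda>h. u t h * cos (h - b)) has_integral l * (k\<^sup>2 * cos (M t - b)) + e b) {a..a+pi}"
      by simp
    then show ?thesis unfolding X_strip by (simp add: a_def integral_unique)
  qed
  have N2: "(N t)\<^sup>2 = (l * k)\<^sup>2 + 2 * (l * e (M t)) + V"
  proof -
    have "((\<lambda>h. l\<^sup>2 * (cos (h - M t))\<^sup>2 + 2 * l * (v h * cos (h - M t)) + (v h)\<^sup>2) has_integral
        l\<^sup>2 * k\<^sup>2 + 2 * l * e (M t) + V) {a..a+pi}"
      unfolding cos_sq_M[symmetric] e_def V_def
      by (intro has_integral_add has_integral_mult_right
          integrable_integral integrable_continuous_interval continuous_intros cv)
    moreover have "l\<^sup>2 * (cos (h - M t))\<^sup>2 + 2 * l * (v h * cos (h - M t)) + (v h)\<^sup>2 = (u t h)\<^sup>2" for h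
      by (simp add: v_def sin_M power2_eq_square algebra_simps)
    ultimately have "((\<lambda>h. (u t h)\<^sup>2) has_integral l\<^sup>2 * k\<^sup>2 + 2 * l * e (M t) + V) {a..a+pi}"
      by simp
    then show ?thesis unfolding N_sq I_strip
      by (simp add: a_def integral_unique power_mult_distrib)
  qed
  \<comment> \<open>From here to \<open>diff\<close>: the triangle inequality in L^2 for u = l sin +
    v, which says that \<open>l * k\<close> differs from \<open>N t\<close> by at most sqrt
    V.\<close>
  have le: "\<bar>l * e (M t)\<bar> \<le> l * k * sqrt V"
    using eM mult_left_mono[OF eM \<open>l \<ge> 0\<close>] \<open>l \<ge> 0\<close> by (simp add: abs_mult mult.assoc)
  have sV: "(sqrt V)\<^sup>2 = V" "sqrt V \<ge> 0" using \<open>V \<ge> 0\<close> by simp_all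
  have "(N t)\<^sup>2 \<le> (l * k + sqrt V)\<^sup>2" using le by (simp add: N2 power2_sum sV)
  then have up: "N t \<le> l * k + sqrt V"
    by (rule power2_le_imp_le) (use \<open>l \<ge> 0\<close> k(1) sV in auto)
  have "(l * k - sqrt V)\<^sup>2 \<le> (N t)\<^sup>2" 
    unfolding N2 power2_diff sV(1) using le by linarith
  then have lo: "l * k - sqrt V \<le> N t"
    by (rule power2_le_imp_le) (use N_pos[OF assms] in auto)
  have diff: "\<bar>l * k - N t\<bar> \<le> sqrt V" using up lo by simp
  have "N t * (G b t - k * cos (M t - b)) = k * cos (M t - b) * (l * k - N t) + e b"
  proof -
    have "N t * G b t = l * (k\<^sup>2 * cos (M t - b)) + e b"
      using N_pos[OF assms] X_eq[of b] by (simp add: G_def)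
    then show ?thesis by (simp add: right_diff_distrib power2_eq_square mult_ac)
  qed
  then have "N t * \<bar>G b t - k * cos (M t - b)\<bar> = \<bar>k * cos (M t - b) * (l * k - N t) + e b\<bar>"
    using N_pos[OF assms] by (metis abs_mult abs_of_pos)
  also have "\<dots> \<le> \<bar>k * cos (M t - b) * (l * k - N t)\<bar> + \<bar>e b\<bar>" by (rule abs_triangle_ineq)
  also have "\<bar>k * cos (M t - b) * (l * k - N t)\<bar> \<le> sqrt pi * 1 * sqrt V"
    unfolding abs_mult using k diff by (intro mult_mono) auto
  also have "sqrt pi * 1 * sqrt V + \<bar>e b\<bar> \<le> 2 * (sqrt pi * sqrt V)" using e_le by simp
  also have "\<dots> \<le> 2 * (sqrt pi * (sqrt pi * sqrt (q t) * N t))"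
    using V_le by (intro mult_left_mono) auto
  also have "\<dots> = N t * (2 * pi * sqrt (q t))" by simp
  finally show ?thesis using N_pos[OF assms] by (simp add: k_def)
qed

lemma G_mid_nonneg:
  assumes "I t > 0"
  shows "G (M t) t \<ge> 0"
proof -
  have "X (M t) t \<ge> 0" unfolding X_strip
  proof (intro integral_nonneg integrable_continuous_interval continuous_intros cont_slice)
    fix h assume "h \<in> {S t - pi..S t - pi + pi}"
    then have "cos (h - M t) \<ge> 0" by (intro cos_ge_zero) (auto simp: M_def)
    then show "u t h * cos (h - M t) \<ge> 0" using u_nonneg by simp
  qed
  then show ?thesis using N_pos[OF assms] by (simp add: G_def)
qed

text \<open>\<open>G b t\<close> is a component of the first Fourier coefficient of \<open>u / N\<close>. It varies little where \<open>p\<close>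
  varies little, while at the two end points its direction is close to that of \<open>M\<close>.
  Rotations by more than \<open>\<pi>\<close> must be excluded separately: on the way, \<open>u\<close> would live in the half-plane
  opposite to the initial one.\<close>

lemma S_increment:
  assumes "x < y" "y \<le> x + 2"
    and I: "\<And>z. x \<le> z \<Longrightarrow> z \<le> y \<Longrightarrow> I z > 0"
    and qp: "\<And>z. x \<le> z \<Longrightarrow> z \<le> y \<Longrightarrow> 2 * pi * q z \<le> L * p' z"
    and D: "p' x \<le> D" "p' y \<le> D" "p y - p x \<le> D" and "L > 0"
    and small: "8 * sqrt (L * D) < 1"
  shows "S y - S x \<le> 16 * sqrt (L * D)"
proof -
  define E where "E = sqrt (L * D)"
  define k where "k = sqrt (pi/2)"
  have k: "k \<ge> 1" using pi_ge_two by (simp add: k_def)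
  have q0: "2 * pi * q z \<ge> 0" if "x \<le> z" "z \<le> y" for z using q_nonneg I that by simp
  have p'0: "p' z \<ge> 0" if "x \<le> z" "z \<le> y" for z
    using order_trans[OF q0[OF that] qp[OF that]] \<open>L > 0\<close> by (simp add: zero_le_mult_iff)
  have "D \<ge> 0" using p'0[of x] D \<open>x < y\<close> by simp
  then have "L * D \<ge> 0" using \<open>L > 0\<close> by simp
  then have E: "E \<ge> 0" "E\<^sup>2 = L * D" by (simp_all add: E_def)
  \<comment> \<open>The error in \<open>G_approx\<close> is the root of 2 pi (2 pi q) <= 2 pi L D,
    and 9 is a convenient square above 2 pi.\<close>
  have err: "\<bar>G b z - k * cos (M z - b)\<bar> \<le> 3 * E" if "z = x \<or> z = y" for b z
  proof -
    have z: "x \<le> z" "z \<le> y" using that \<open>x < y\<close> by auto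
    have "2 * pi * q z \<le> L * p' z" using qp z by blast
    also have "\<dots> \<le> L * D" using D that \<open>L > 0\<close> by (intro mult_left_mono) auto
    finally have "2 * pi * (2 * pi * q z) \<le> 2 * pi * (L * D)"
      by (intro mult_left_mono) auto
    also have "\<dots> \<le> 9 * (L * D)"
      using \<open>L * D \<ge> 0\<close> pi_approx by (intro mult_right_mono) auto
    also have "9 * (L * D) = (3 * E)\<^sup>2" by (simp add: power_mult_distrib E(2))
    also have "2 * pi * (2 * pi * q z) = (2 * pi * sqrt (q z))\<^sup>2"
      using q_nonneg[OF I[OF z]] by (simp add: power_mult_distrib) (simp add: power2_eq_square)
    finally have "(2 * pi * sqrt (q z))\<^sup>2 \<le> (3 * E)\<^sup>2" .
    then have "2 * pi * sqrt (q z) \<le> 3 * E" by (rule power2_le_imp_le) (use E in auto)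
    then show ?thesis using G_approx[OF I[OF z], of b] by (simp add: k_def)
  qed
  \<comment> \<open>Leads to \<open>G_inc\<close>: over a length of at most 2, the square of the
    increment of \<open>G b\<close> is at most 2 L D <= (2 E)^2.\<close>
  have p_mono: "p z \<le> p y" if "x \<le> z" "z \<le> y" for z
    using that by (intro nondecreasing_if_deriv_nonneg[of z y p p'] p_deriv I p'0) auto
  have G_inc: "\<bar>G b z - G b x\<bar> \<le> 2 * E" if "x \<le> z" "z \<le> y" for b z
  proof (cases "x = z")
    case False
    then have "x < z" using that by simp
    then have "(G b z - G b x)\<^sup>2 \<le> L * (z - x) * (p z - p x)"
      using that I by (intro increment_bound[where g' = "G' b" and p' = p'] G_deriv p_deriv
        order_trans[OF G'_le qp]) auto
    also have "\<dots> \<le> L * 2 * D"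
    proof (rule mult_mono')
      show "L * (z - x) \<le> L * 2" using that assms by simp
      show "p z - p x \<le> D" using p_mono[OF that] D by simp
      show "0 \<le> L * (z - x)" using that assms by simp
      show "0 \<le> p z - p x"
      proof -
        have "p x \<le> p z"
          using that by (intro nondecreasing_if_deriv_nonneg[of x z p p'] p_deriv I p'0) auto
        then show ?thesis by simp
      qed
    qed
    also have "\<dots> \<le> (2 * E)\<^sup>2"
      unfolding power_mult_distrib E(2) using \<open>L * D \<ge> 0\<close> by (simp add: mult.commute)
    finally have "\<bar>G b z - G b x\<bar> \<le> \<bar>2 * E\<bar>" by (simp only: abs_le_square_iff)
    then show ?thesis using E by simp
  qed (use E in simp)
  define d where "d = S y - S x"
  have "d \<ge> 0" using mono_S \<open>x < y\<close> by (simp add: d_def monoD)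
  \<comment> \<open>Where S has grown by pi, \<open>M\<close> points the opposite way and
    \<open>G (M x)\<close> is at most 0. But it starts at k - 3 E or more and loses at most 2 E,
    while 5 E < 1 <= k.\<close>
  have "d \<le> pi"
  proof (rule ccontr)
    assume "\<not> d \<le> pi"
    then have "\<exists>z\<ge>x. z \<le> y \<and> S z = S x + pi"
      using \<open>x < y\<close> cont_S continuous_on_subset by (intro IVT') (auto simp: d_def)
    then obtain z where z: "x \<le> z" "z \<le> y" "S z = S x + pi" by blast
    have "cos (h - M z) = - cos (h - M x)" for h
      using cos_periodic_pi[of "h - M z"] z by (simp add: M_def algebra_simps)
    then have "G (M z) z = - G (M x) z"
      by (simp add: G_def X_def)
    then have "G (M x) z \<le> 0" using G_mid_nonneg[OF I[OF z(1,2)]] by simp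
    moreover have "k \<le> G (M x) x + 3 * E" using err[of x "M x"] by simp
    moreover have "G (M x) x \<le> G (M x) z + 2 * E" using G_inc[OF z(1,2), of "M x"] by simp
    ultimately show False using small k by (simp add: E_def)
  qed
  \<comment> \<open>Orthogonal to the mean direction, so that the two cosines are opposite and
    differ by 2 sin (d/2). The bound 8 E is 3 E at each end plus 2 E for the increment.\<close>
  define b where "b = (M x + M y) / 2 - pi/2"
  have "M x - b = pi/2 - d/2" "M y - b = pi/2 - (- (d/2))"
    by (simp_all add: b_def d_def M_def field_simps)
  then have "cos (M x - b) = sin (d/2)" "cos (M y - b) = - sin (d/2)"
    using sin_cos_eq[of "d/2"] sin_cos_eq[of "- (d/2)"] by simp_all
  then have "k * cos (M x - b) - k * cos (M y - b) = 2 * (k * sin (d/2))" by simp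
  moreover have "\<bar>k * cos (M x - b) - k * cos (M y - b)\<bar> \<le> 8 * E"
    using err[of x b] err[of y b] G_inc[of y b] \<open>x < y\<close> by simp
  ultimately have "k * sin (d/2) \<le> 4 * E" by simp
  moreover have s: "2 * (d/2) / pi \<le> sin (d/2)" using \<open>d \<ge> 0\<close> \<open>d \<le> pi\<close> by (intro sin_ge_chord) auto
  moreover have "sin (d/2) \<ge> 0" using \<open>d \<ge> 0\<close> \<open>d \<le> pi\<close> by (intro sin_ge_zero) auto
  then have "1 * sin (d/2) \<le> k * sin (d/2)" using k by (intro mult_right_mono) auto
  ultimately have "d / pi \<le> 4 * E" by simp
  then have "d \<le> 4 * E * pi" by (simp add: field_simps)
  also have "\<dots> \<le> 4 * E * 4" using E pi_less_4 by (intro mult_left_mono) auto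
  finally show ?thesis by (simp add: d_def E_def)
qed

section \<open>Two-sided growth of the norm and square-summable rotation\<close>

lemma N_lower:
  assumes "I T > 0" "T + 1 \<le> t" and pge: "\<And>x. x \<ge> T \<Longrightarrow> p x \<ge> p0" and "p0 \<ge> 0"
  shows "N t * exp (- t) \<ge> p0 / 4"
proof -
  \<comment> \<open>The derivative of N exp x is p exp (2 x) >= p0 exp (2 x), so \<open>H\<close> is
    nondecreasing. One unit of distance from \<open>T\<close> gives exp t >= 2 exp T, and at least
    half of exp (2 t) survives.\<close>
  define H where "H = (\<lambda>x. N x * exp x - p0 / 2 * (exp x)\<^sup>2)"
  have "H T \<le> H t"
  proof (rule DERIV_nonneg_imp_nondecreasing[of T t H])
    fix x assume "T \<le> x" "x \<le> t"
    then have Ix: "I x > 0" using I_mono[of T x] assms by simp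
    have "(H has_real_derivative N' x * exp x + N x * exp x - p0 * (exp x)\<^sup>2) (at x)"
      unfolding H_def by (auto intro!: derivative_eq_intros N_deriv Ix simp: power2_eq_square)
    moreover have "N' x * exp x + N x * exp x - p0 * (exp x)\<^sup>2 = (p x - p0) * (exp x)\<^sup>2"
    proof -
      have "exp (- x) * exp x = 1" by (simp flip: exp_add)
      then have "(N' x + N x) * exp x = (N' x + N x) * (exp (- x) * exp x) * exp x" by simp
      then show ?thesis by (simp add: p_def power2_eq_square algebra_simps)
    qed
    moreover have "(p x - p0) * (exp x)\<^sup>2 \<ge> 0" using pge[OF \<open>T \<le> x\<close>] by simp
    ultimately show "\<exists>y. (H has_real_derivative y) (at x) \<and> 0 \<le> y" by auto
  qed (use assms in simp)
  then have 1: "N t * exp t \<ge> p0 / 2 * ((exp t)\<^sup>2 - (exp T)\<^sup>2)"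
    using mult_pos_pos[OF N_pos[OF assms(1)] exp_gt_zero[of T]] by (simp add: H_def right_diff_distrib)
  have "(2 * exp T) \<le> exp t"
  proof -
    have "2 * exp T \<le> exp (1::real) * exp T" using exp_ge_add_one_self[of 1] by (intro mult_right_mono) auto
    also have "\<dots> \<le> exp t" using assms by (simp flip: exp_add)
    finally show ?thesis .
  qed
  then have "(2 * exp T)\<^sup>2 \<le> (exp t)\<^sup>2" by (intro power_mono) auto
  then have "4 * (exp T)\<^sup>2 \<le> (exp t)\<^sup>2" by (simp add: power_mult_distrib)
  then have "(exp t)\<^sup>2 - (exp T)\<^sup>2 \<ge> (exp t)\<^sup>2 / 2"
    using zero_le_power2[of "exp T"] by linarith
  then have "p0 / 2 * ((exp t)\<^sup>2 - (exp T)\<^sup>2) \<ge> p0 / 2 * ((exp t)\<^sup>2 / 2)"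
    using \<open>p0 \<ge> 0\<close> by (intro mult_left_mono) auto
  with 1 have "N t * exp t \<ge> p0 / 4 * (exp t)\<^sup>2" by simp
  then have le: "p0 / 4 * (exp t)\<^sup>2 * (exp (- t))\<^sup>2 \<le> N t * exp t * (exp (- t))\<^sup>2" by (rule mult_right_mono) simp
  have "exp t * exp (- t) = 1" by (simp flip: exp_add)
  then have eqs: "p0 / 4 * (exp t)\<^sup>2 * (exp (- t))\<^sup>2 = p0 / 4" "N t * exp t * (exp (- t))\<^sup>2 = N t * exp (- t)"
    by (simp_all add: power2_eq_square mult_ac flip: power_mult_distrib)
  from le show ?thesis unfolding eqs .
qed

text \<open>For t >= 0 the 1 in \<open>growth\<close> is absorbed by exp t; 6 arises from 2 pi 2^2
  <= 9 * 4.\<close>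

lemma N_upper: assumes "t \<ge> 0" shows "N t * exp (- t) \<le> 6 * C"
proof -
  have "1 + exp t \<le> 2 * exp t" using assms by simp
  then have "C * (1 + exp t) \<le> C * (2 * exp t)" by (intro mult_left_mono C_nonneg)
  then have "(C * (1 + exp t))\<^sup>2 \<le> (C * (2 * exp t))\<^sup>2" using C_nonneg by (intro power_mono) auto
  then have "2 * pi * (C * (1 + exp t))\<^sup>2 \<le> 2 * pi * (C * (2 * exp t))\<^sup>2" by (intro mult_left_mono) auto
  also have "\<dots> \<le> 9 * (C * (2 * exp t))\<^sup>2" using pi_approx by (intro mult_right_mono) auto
  also have "\<dots> = (6 * C * exp t)\<^sup>2" by (simp add: power_mult_distrib)
  finally have "(N t)\<^sup>2 \<le> (6 * C * exp t)\<^sup>2" using I_le[of t] by (simp add: N_sq)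
  then have "N t \<le> 6 * C * exp t" by (rule power2_le_imp_le) (use C_nonneg in auto)
  then have "N t * exp (- t) \<le> 6 * C * exp t * exp (- t)" by (rule mult_right_mono) simp
  also have "\<dots> = 6 * C" by (simp add: mult.assoc flip: exp_add)
  finally show ?thesis .
qed

lemma I_pos_imp_slow_rotation:
  assumes It0: "I t0 > 0" and "c > 0"
  shows "\<forall>\<^sub>F t in at_top. S t < c * sqrt t"
proof -
  have Ipos: "I t > 0" if "t \<ge> t0" for t using I_mono[OF that] It0 by simp
  have p'0: "p' t \<ge> 0" if "t \<ge> t0" for t
    using p'_ge[OF Ipos[OF that]] q_nonneg[OF Ipos[OF that]] N_pos[OF Ipos[OF that]]
    by (meson exp_ge_zero less_imp_le mult_nonneg_nonneg order_trans)
  have p_mono: "p x \<le> p y" if "t0 \<le> x" "x \<le> y" for x y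
    using that by (intro nondecreasing_if_deriv_nonneg[of x y p p'] p_deriv Ipos p'0) auto
  define p0 where "p0 = p t0"
  have "p0 > 0" using N_pos[OF It0] I'_nonneg[of t0] by (simp add: p0_def p_def N'_def add_nonneg_pos)
  have lower: "N t * exp (- t) \<ge> p x / 4" if "t0 \<le> x" "x + 1 \<le> t" for x t
    using that p_mono[of x] p_mono[of t0 x] \<open>p0 > 0\<close>
    by (intro N_lower[of x] Ipos) (auto simp: p0_def)
  have p_bdd: "p x \<le> 24 * C" if "t0 \<le> x" "0 \<le> x" for x
    using lower[of x "x + 1"] N_upper[of "x + 1"] that by simp
  \<comment> \<open>Solves L * (p0 / 4) = 2 pi, where p0 / 4 is the lower bound for N exp (-
    t).\<close>
  define L where "L = 8 * pi / p0"
  have "L > 0" using \<open>p0 > 0\<close> by (simp add: L_def)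
  have qp: "2 * pi * q t \<le> L * p' t" if "t \<ge> t0 + 1" for t
  proof -
    have I: "I t > 0" using that by (intro Ipos) simp
    have "p0 / 4 * q t \<le> N t * exp (- t) * q t"
      using lower[of t0 t] that q_nonneg[OF I] by (intro mult_right_mono) (auto simp: p0_def)
    also have "\<dots> \<le> p' t" by (rule p'_ge[OF I])
    finally have "L * (p0 / 4 * q t) \<le> L * p' t" using \<open>L > 0\<close> by (intro mult_left_mono) auto
    then show ?thesis using \<open>p0 > 0\<close> by (simp add: L_def)
  qed
  define n0 where "n0 = nat \<lceil>max 0 (t0 + 1)\<rceil>"
  have n0: "real n0 \<ge> t0 + 1" unfolding n0_def by linarith
  define D where "D = (\<lambda>k. p (real (k + n0) + 1) - p (real (k + n0)))"
  \<comment> \<open>Points where \<open>p'\<close>, and hence \<open>q\<close>, is controlled by a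
    unit increment of \<open>p\<close>. Neighbouring points lie in two adjacent unit intervals, over
    which \<open>p\<close> grows by \<open>D k + D (Suc k)\<close>.\<close>
  have "\<exists>z. real (k + n0) < z \<and> z < real (k + n0) + 1 \<and> p' z = D k" for k
  proof -
    have "\<exists>z>real (k + n0). z < real (k + n0) + 1
        \<and> p (real (k + n0) + 1) - p (real (k + n0)) = (real (k + n0) + 1 - real (k + n0)) * p' z"
      using n0 by (intro MVT2 p_deriv Ipos) auto
    then show ?thesis by (auto simp: D_def)
  qed
  then obtain a where a: "\<And>k. real (k + n0) < a k" "\<And>k. a k < real (k + n0) + 1" "\<And>k. p' (a k) = D k"
    by metis
  have D0: "D k \<ge> 0" for k
    using p_mono[of "real (k + n0)" "real (k + n0) + 1"] n0 by (simp add: D_def)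
  have sumD: "(\<Sum>k<n. D k) = p (real (n + n0)) - p (real n0)" for n
    
  proof (induction n)
    case (Suc n)
    have "real (Suc n + n0) = real (n + n0) + 1" by simp
    with Suc show ?case by (simp only: D_def sum.lessThan_Suc)
  qed simp
  have "summable D"
  proof (rule summableI_nonneg_bounded[OF D0])
    show "(\<Sum>k<n. D k) \<le> 24 * C - p (real n0)" for n
      using p_bdd[of "real (n + n0)"] n0 by (simp add: sumD)
  qed
  \<comment> \<open>Provides the smallness hypothesis of \<open>S_increment\<close> for all large
    k.\<close>
  then have "D \<longlonglongrightarrow> 0" by (rule summable_LIMSEQ_zero)
  then have "(\<lambda>k. 8 * sqrt (L * (D k + D (Suc k)))) \<longlonglongrightarrow> 8 * sqrt (L * (0 + 0))"
    by (intro tendsto_intros LIMSEQ_Suc)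
  then have "\<forall>\<^sub>F k in sequentially. 8 * sqrt (L * (D k + D (Suc k))) < 1"
    by (intro order_tendstoD(2)[where y = "8 * sqrt (L * (0 + 0))"]) auto
  then obtain k0 where k0: "\<And>k. k \<ge> k0 \<Longrightarrow> 8 * sqrt (L * (D k + D (Suc k))) < 1"
    unfolding eventually_sequentially by blast
  show ?thesis
  proof (rule eventually_less_sqrt[OF mono_S D0 \<open>summable D\<close>])
    show "real k \<le> a k" for k using a(1)[of k] by simp
    show "S (a (Suc k)) - S (a k) \<le> 16 * sqrt L * sqrt (D k + D (Suc k))" if "k \<ge> k0" for k
    proof -
      have ak: "real (k + n0) < a k" "a k < real (k + n0) + 1"
        "real (k + n0) + 1 < a (Suc k)" "a (Suc k) < real (k + n0) + 2"
        using a(1,2)[of k] a(1,2)[of "Suc k"] by simp_all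
      have "S (a (Suc k)) - S (a k) \<le> 16 * sqrt (L * (D k + D (Suc k)))"
      proof (rule S_increment)
        show "a k < a (Suc k)" "a (Suc k) \<le> a k + 2" using ak by linarith+
        show "I z > 0" "2 * pi * q z \<le> L * p' z" if "a k \<le> z" for z
          using that ak n0 by (auto intro!: Ipos qp)
        show "p' (a k) \<le> D k + D (Suc k)" "p' (a (Suc k)) \<le> D k + D (Suc k)"
          using D0 by (simp_all add: a)
        have "p (a (Suc k)) - p (a k) \<le> p (real (k + n0) + 2) - p (real (k + n0))"
          using ak n0 by (intro diff_mono p_mono) auto
        also have "\<dots> = D k + D (Suc k)"
        proof -
          have "real (Suc k + n0) = real (k + n0) + 1" by simp
          then have "D (Suc k) = p (real (k + n0) + 2) - p (real (k + n0) + 1)"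
            by (simp only: D_def add.assoc one_add_one)
          then show ?thesis by (simp add: D_def)
        qed
        finally show "p (a (Suc k)) - p (a k) \<le> D k + D (Suc k)" .
      qed (use k0 that \<open>L > 0\<close> in auto)
      then show ?thesis by (simp add: real_sqrt_mult)
    qed
  qed (use \<open>L > 0\<close> \<open>c > 0\<close> in auto)
qed

lemma fast_rotation_imp_zero:
  assumes "c > 0" and "\<exists>\<^sub>F t in at_top. c * sqrt t \<le> S t"
  shows "u t h = 0"
proof -
  have "\<not> I t > 0"
    using I_pos_imp_slow_rotation[OF _ \<open>c > 0\<close>] assms(2) by (auto simp: frequently_def not_le)
  then have "I t = 0" using I_nonneg[of t] by simp
  then have "integral {h..h + 2 * pi} (\<lambda>h. (u t h)\<^sup>2) = 0"
    unfolding I_def using u_periodic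
    by (subst integral_periodic) (auto intro!: continuous_intros cont_slice)
  then have "\<forall>x\<in>{h..h + 2 * pi}. (u t x)\<^sup>2 = 0"
    by (subst (asm) integral_eq_0_iff) (auto intro!: continuous_intros cont_slice)
  then show ?thesis by simp
qed

end

subsection \<open>Passage to holomorphic functions\<close>

text \<open>A \<open>C\<^sup>2\<close> substitute \<open>\<Psi>\<close> for \<open>ln\<^sup>+ y\<close> with \<open>y \<Psi>'(y) = (1 - 1/y)\<^sup>2\<close> for \<open>y \<ge> 1\<close>; that
  \<open>y \<Psi>'(y)\<close> is nondecreasing makes \<open>\<Psi>(|F|\<^sup>2)\<close> subharmonic for holomorphic \<open>F\<close>.\<close>

definition smooth_ln :: "real \<Rightarrow> real" where
  "smooth_ln y = ln (max 1 y) + 2 / max 1 y - 1 / (2 * (max 1 y)\<^sup>2) - 3/2"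

definition smooth_ln' :: "real \<Rightarrow> real" where
  "smooth_ln' y = (max 1 y - 1)\<^sup>2 / (max 1 y) ^ 3"

definition smooth_ln'' :: "real \<Rightarrow> real" where
  "smooth_ln'' y = - ((max 1 y - 1) * (max 1 y - 3)) / (max 1 y) ^ 4"

section \<open>Smoothness and convexity of Psi\<close>

lemma has_real_derivative_zero_if_quadratic:
  fixes f :: "real \<Rightarrow> real"
  assumes "\<And>x. \<bar>f x\<bar> \<le> (x - a)\<^sup>2"
  shows "(f has_real_derivative 0) (at a)"
proof -
  have "f a = 0" using assms[of a] by simp
  have "((\<lambda>x. \<bar>x - a\<bar>) \<longlongrightarrow> \<bar>a - a\<bar>) (at a)" by (intro tendsto_intros)
  then have *: "((\<lambda>x. \<bar>x - a\<bar>) \<longlongrightarrow> 0) (at a)" by simp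
  have "((\<lambda>x. (f x - f a) / (x - a)) \<longlongrightarrow> 0) (at a)"
  proof (rule Lim_null_comparison[OF _ *], rule eventuallyI)
    fix x
    show "norm ((f x - f a) / (x - a)) \<le> \<bar>x - a\<bar>"
    proof (cases "x = a")
      case False
      have "\<bar>f x\<bar> \<le> \<bar>x - a\<bar> * \<bar>x - a\<bar>" using assms[of x] by (simp add: power2_eq_square)
      then show ?thesis using False \<open>f a = 0\<close> by (simp add: field_simps)
    qed simp
  qed
  then show ?thesis by (simp add: has_field_derivative_iff)
qed

text \<open>Meant for the junction y = 1, where it gives the derivative from both sides at once. It
  needs only ln x <= x - 1, at y and at 1/y.\<close>

lemma abs_smooth_ln_le: "\<bar>smooth_ln y\<bar> \<le> (y - 1)\<^sup>2"
proof (cases "y \<le> 1")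
  case True
  then show ?thesis by (simp add: smooth_ln_def max_def)
next
  case False
  then have y: "y > 1" and m: "max 1 y = y" by auto
  have "ln y \<le> y - 1" using y by (intro ln_le_minus_one) simp
  then have "smooth_ln y \<le> (y - 1) + 2 / y - 1 / (2 * y\<^sup>2) - 3/2" by (simp add: smooth_ln_def m)
  also have "\<dots> = (y - 1)\<^sup>2 * ((y - 1/2) / y\<^sup>2)"
    using y by (simp add: field_simps power2_eq_square)
  also have "\<dots> \<le> (y - 1)\<^sup>2 * 1"
  proof (rule mult_left_mono)
    have "y * 1 \<le> y * y" using y by (intro mult_left_mono) auto
    then have "y * 2 \<le> 1 + y * (y * 2)" by simp
    then show "(y - 1/2) / y\<^sup>2 \<le> 1" using y by (simp add: power2_eq_square field_simps)
  qed simp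
  finally have up: "smooth_ln y \<le> (y - 1)\<^sup>2" by simp
  have "- ln y = ln (1 / y)" using y by (simp add: ln_div)
  also have "\<dots> \<le> 1 / y - 1" using y by (intro ln_le_minus_one) simp
  finally have "smooth_ln y \<ge> (1 - 1 / y) + 2 / y - 1 / (2 * y\<^sup>2) - 3/2"
    unfolding smooth_ln_def m by linarith
  also have "(1 - 1 / y) + 2 / y - 1 / (2 * y\<^sup>2) - 3/2 = - ((y - 1)\<^sup>2 * (1 / (2 * y\<^sup>2)))"
    using y by (simp add: field_simps power2_eq_square)
  also have "(y - 1)\<^sup>2 * (1 / (2 * y\<^sup>2)) \<le> (y - 1)\<^sup>2 * 1"
  proof (rule mult_left_mono)
    have "1 * 1 \<le> y * y" using y by (intro mult_mono) auto
    then show "1 / (2 * y\<^sup>2) \<le> 1" using y by (simp add: power2_eq_square field_simps)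
  qed simp
  then have "- ((y - 1)\<^sup>2 * (1 / (2 * y\<^sup>2))) \<ge> - (y - 1)\<^sup>2" by simp
  finally show ?thesis using up by simp
qed

lemma abs_smooth_ln'_le: "\<bar>smooth_ln' y\<bar> \<le> (y - 1)\<^sup>2"
proof (cases "y \<le> 1")
  case False
  then have y: "y > 1" and m: "max 1 y = y" by auto
  have "(y - 1)\<^sup>2 / y ^ 3 \<le> (y - 1)\<^sup>2 / 1"
    using y by (intro divide_left_mono one_le_power) auto
  then show ?thesis using y by (simp add: smooth_ln'_def m)
qed (simp add: smooth_ln'_def max_def)

lemma smooth_ln_deriv: "(smooth_ln has_real_derivative smooth_ln' y) (at y)"
proof -
  consider "y < 1" | "y = 1" | "y > 1" by linarith
  then show ?thesis
  proof cases
    case 1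
    have "((\<lambda>_. 0) has_real_derivative 0) (at y)" by simp
    then have "(smooth_ln has_real_derivative 0) (at y)"
      by (rule has_field_derivative_transform_within_open[of _ _ _ "{..<1}"])
        (use 1 in \<open>auto simp: smooth_ln_def max_def\<close>)
    then show ?thesis using 1 by (simp add: smooth_ln'_def)
  next
    case 2
    then show ?thesis
      using has_real_derivative_zero_if_quadratic[OF abs_smooth_ln_le] by (simp add: smooth_ln'_def)
  next
    case 3
    have "((\<lambda>y. ln y + 2 / y - 1 / (2 * y\<^sup>2) - 3/2) has_real_derivative (y - 1)\<^sup>2 / y ^ 3) (at y)"
      using 3 by (auto intro!: derivative_eq_intros simp: field_simps power2_eq_square power3_eq_cube)
    then have "(smooth_ln has_real_derivative (y - 1)\<^sup>2 / y ^ 3) (at y)"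
      by (rule has_field_derivative_transform_within_open[of _ _ _ "{1<..}"])
        (use 3 in \<open>auto simp: smooth_ln_def max_def\<close>)
    then show ?thesis using 3 by (simp add: smooth_ln'_def)
  qed
qed

lemma smooth_ln'_deriv: "(smooth_ln' has_real_derivative smooth_ln'' y) (at y)"
proof -
  consider "y < 1" | "y = 1" | "y > 1" by linarith
  then show ?thesis
  proof cases
    case 1
    have "((\<lambda>_. 0) has_real_derivative 0) (at y)" by simp
    then have "(smooth_ln' has_real_derivative 0) (at y)"
      by (rule has_field_derivative_transform_within_open[of _ _ _ "{..<1}"])
        (use 1 in \<open>auto simp: smooth_ln'_def max_def\<close>)
    then show ?thesis using 1 by (simp add: smooth_ln''_def)
  next
    case 2
    then show ?thesis
      using has_real_derivative_zero_if_quadratic[OF abs_smooth_ln'_le] by (simp add: smooth_ln''_def)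
  next
    case 3
    have "((\<lambda>y. (y - 1)\<^sup>2 / y ^ 3) has_real_derivative
        (2 * (y - 1) * y ^ 3 - (y - 1)\<^sup>2 * (3 * y\<^sup>2)) / (y ^ 3 * y ^ 3)) (at y)"
      using 3 by (auto intro!: derivative_eq_intros)
    moreover have "(2 * (y - 1) * y ^ 3 - (y - 1)\<^sup>2 * (3 * y\<^sup>2)) / (y ^ 3 * y ^ 3)
        = - ((y - 1) * (y - 3)) / y ^ 4"
      using 3 by (simp add: field_simps eval_nat_numeral)
    ultimately have "((\<lambda>y. (y - 1)\<^sup>2 / y ^ 3) has_real_derivative - ((y - 1) * (y - 3)) / y ^ 4) (at y)"
      by simp
    then have "(smooth_ln' has_real_derivative - ((y - 1) * (y - 3)) / y ^ 4) (at y)"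
      by (rule has_field_derivative_transform_within_open[of _ _ _ "{1<..}"])
        (use 3 in \<open>auto simp: smooth_ln'_def max_def\<close>)
    then show ?thesis using 3 by (simp add: smooth_ln''_def)
  qed
qed

lemma continuous_on_smooth_ln'': "continuous_on A smooth_ln''"
  unfolding smooth_ln''_def[abs_def] by (intro continuous_intros) (auto simp: max_def)

lemma smooth_ln_eq_0: "y \<le> 1 \<Longrightarrow> smooth_ln y = 0"
  by (simp add: smooth_ln_def max_def)

lemma smooth_ln_pos: assumes "y > 1" shows "smooth_ln y > 0"
proof -
  obtain z where z: "1 < z" "smooth_ln y - smooth_ln 1 = (y - 1) * smooth_ln' z"
    using MVT2[OF assms, of smooth_ln smooth_ln'] smooth_ln_deriv by blast
  then show ?thesis using assms by (simp add: smooth_ln_eq_0 smooth_ln'_def)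
qed

lemma smooth_ln_nonneg: "smooth_ln y \<ge> 0"
  using smooth_ln_pos[of y] smooth_ln_eq_0[of y] by (cases "y \<le> 1") auto

lemma smooth_ln_le: "smooth_ln y \<le> ln (max 1 y)"
proof -
  define m where "m = max 1 y"
  have m: "m \<ge> 1" by (simp add: m_def)
  have "0 \<le> (3 * m - 1) * (m - 1)" using m by simp
  then have "2 / m - 1 / (2 * m\<^sup>2) \<le> 3/2" using m by (simp add: field_simps power2_eq_square)
  then show ?thesis by (simp add: smooth_ln_def flip: m_def)
qed

text \<open>The left side is the derivative of y Psi'(y); for y > 0 its sign is that of the second
  derivative of x -> Psi(exp x).\<close>

lemma smooth_ln_convexity: "y * smooth_ln'' y + smooth_ln' y \<ge> 0"
proof (cases "y \<le> 1")
  case False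
  then have y: "y > 1" and m: "max 1 y = y" by auto
  have "y * smooth_ln'' y + smooth_ln' y = 2 * (y - 1) / y ^ 3"
    using y by (simp add: smooth_ln'_def smooth_ln''_def m field_simps eval_nat_numeral)
  then show ?thesis using y by simp
qed (simp add: smooth_ln'_def smooth_ln''_def max_def)

section \<open>Holomorphic functions in logarithmic coordinates\<close>

lemma
  assumes "(F has_field_derivative d) (at (Complex t h))"
  shows Re_deriv_t: "((\<lambda>t. Re (F (Complex t h))) has_real_derivative Re d) (at t)"
    and Im_deriv_t: "((\<lambda>t. Im (F (Complex t h))) has_real_derivative Im d) (at t)"
    and Re_deriv_h: "((\<lambda>h. Re (F (Complex t h))) has_real_derivative - Im d) (at h)"
    and Im_deriv_h: "((\<lambda>h. Im (F (Complex t h))) has_real_derivative Re d) (at h)"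
proof -
  \<comment> \<open>The Cauchy-Riemann equations by the chain rule along two lines with velocities 1
    and i.\<close>
  have "((\<lambda>t. Complex t h) has_vector_derivative 1) (at t)"
    unfolding Complex_eq by (auto intro!: derivative_eq_intros)
  from field_vector_diff_chain_at[OF this assms]
  have t: "((\<lambda>t. F (Complex t h)) has_vector_derivative d) (at t)" by (simp add: o_def)
  have "((\<lambda>h. Complex t h) has_vector_derivative \<i>) (at h)"
    unfolding Complex_eq by (auto intro!: derivative_eq_intros)
  from field_vector_diff_chain_at[OF this assms]
  have h: "((\<lambda>h. F (Complex t h)) has_vector_derivative \<i> * d) (at h)" by (simp add: o_def)
  show "((\<lambda>t. Re (F (Complex t h))) has_real_derivative Re d) (at t)"
    "((\<lambda>t. Im (F (Complex t h))) has_real_derivative Im d) (at t)"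
    "((\<lambda>h. Re (F (Complex t h))) has_real_derivative - Im d) (at h)"
    "((\<lambda>h. Im (F (Complex t h))) has_real_derivative Re d) (at h)"
    using bounded_linear.has_vector_derivative[OF bounded_linear_Re t]
      bounded_linear.has_vector_derivative[OF bounded_linear_Im t]
      bounded_linear.has_vector_derivative[OF bounded_linear_Re h]
      bounded_linear.has_vector_derivative[OF bounded_linear_Im h]
    by (simp_all add: has_real_derivative_iff_has_vector_derivative)
qed

text \<open>\<open>rotating_strip\<close> is applied to Psi(|F|^2). That Psi vanishes says no more
  than |F| <= 1, so constancy is left to Liouville's theorem.\<close>

lemma holomorphic_rotating_strip:
  fixes F dF ddF :: "complex \<Rightarrow> complex"
  assumes F: "\<And>z. (F has_field_derivative dF z) (at z)"
    and dF: "\<And>z. (dF has_field_derivative ddF z) (at z)"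
    and ddF: "continuous_on UNIV ddF"
    and per: "\<And>z. F (z + 2 * of_real pi * \<i>) = F z" "\<And>z. dF (z + 2 * of_real pi * \<i>) = dF z"
    and S: "mono S" "continuous_on UNIV S"
    and le1: "\<And>t h. S t \<le> h \<Longrightarrow> h \<le> S t + pi \<Longrightarrow> norm (F (Complex t h)) \<le> 1"
    and growth: "\<And>t h. ln (max 1 ((norm (F (Complex t h)))\<^sup>2)) \<le> C * (1 + exp t)"
    and "c > 0" "\<exists>\<^sub>F t in at_top. c * sqrt t \<le> S t"
  shows "norm (F z) \<le> 1"
proof -
  define P P1 P2 Q Q1 Q2 where "P = (\<lambda>t h. Re (F (Complex t h)))"
    and "P1 = (\<lambda>t h. Re (dF (Complex t h)))" and "P2 = (\<lambda>t h. Re (ddF (Complex t h)))"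
    and "Q = (\<lambda>t h. Im (F (Complex t h)))"
    and "Q1 = (\<lambda>t h. Im (dF (Complex t h)))" and "Q2 = (\<lambda>t h. Im (ddF (Complex t h)))"
  note defs = P_def P1_def P2_def Q_def Q1_def Q2_def
  have dt: "((\<lambda>t. P t h) has_real_derivative P1 t h) (at t)" "((\<lambda>t. Q t h) has_real_derivative Q1 t h) (at t)"
    "((\<lambda>t. P1 t h) has_real_derivative P2 t h) (at t)" "((\<lambda>t. Q1 t h) has_real_derivative Q2 t h) (at t)" for t h
    unfolding defs by (intro Re_deriv_t Im_deriv_t F dF)+
  have dh: "((\<lambda>h. P t h) has_real_derivative - Q1 t h) (at h)" "((\<lambda>h. Q t h) has_real_derivative P1 t h) (at h)"
    "((\<lambda>h. P1 t h) has_real_derivative - Q2 t h) (at h)" "((\<lambda>h. Q1 t h) has_real_derivative P2 t h) (at h)" for t h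
    unfolding defs by (intro Re_deriv_h Im_deriv_h F dF)+
  have cF: "continuous_on UNIV F" "continuous_on UNIV dF"
    using F dF by (auto intro!: continuous_at_imp_continuous_on DERIV_isCont)
  have cont: "continuous_on UNIV (\<lambda>x. P (fst x) (snd x))" "continuous_on UNIV (\<lambda>x. P1 (fst x) (snd x))"
    "continuous_on UNIV (\<lambda>x. P2 (fst x) (snd x))" "continuous_on UNIV (\<lambda>x. Q (fst x) (snd x))"
    "continuous_on UNIV (\<lambda>x. Q1 (fst x) (snd x))" "continuous_on UNIV (\<lambda>x. Q2 (fst x) (snd x))"
    unfolding defs Complex_eq
    by (intro continuous_intros continuous_on_compose2[OF cF(1)] continuous_on_compose2[OF cF(2)]
        continuous_on_compose2[OF ddF]; simp)+
  have shift: "Complex t (h + 2 * pi) = Complex t h + 2 * of_real pi * \<i>" for t h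
    by (simp add: complex_eq_iff)
  have perPQ: "P t (h + 2 * pi) = P t h" "Q t (h + 2 * pi) = Q t h"
    "P1 t (h + 2 * pi) = P1 t h" "Q1 t (h + 2 * pi) = Q1 t h" for t h
    unfolding defs shift per by (rule refl)+
  define y where "y = (\<lambda>t h. (P t h)\<^sup>2 + (Q t h)\<^sup>2)"
  define yt where "yt = (\<lambda>t h. 2 * (P t h * P1 t h + Q t h * Q1 t h))"
  define yh where "yh = (\<lambda>t h. 2 * (Q t h * P1 t h - P t h * Q1 t h))"
  define ytt where "ytt = (\<lambda>t h. 2 * ((P1 t h)\<^sup>2 + (Q1 t h)\<^sup>2 + P t h * P2 t h + Q t h * Q2 t h))"
  define yhh where "yhh = (\<lambda>t h. 2 * ((P1 t h)\<^sup>2 + (Q1 t h)\<^sup>2 - P t h * P2 t h - Q t h * Q2 t h))"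
  have y_norm: "y t h = (norm (F (Complex t h)))\<^sup>2" for t h
    by (simp add: y_def P_def Q_def cmod_power2)
  have y: "((\<lambda>t. y t h) has_real_derivative yt t h) (at t)" "((\<lambda>h. y t h) has_real_derivative yh t h) (at h)"
    "((\<lambda>t. yt t h) has_real_derivative ytt t h) (at t)" "((\<lambda>h. yh t h) has_real_derivative yhh t h) (at h)"
    for t h
    unfolding y_def yt_def yh_def ytt_def yhh_def
    by (auto intro!: derivative_eq_intros dt dh simp: power2_eq_square algebra_simps)
  have csl: "continuous_on UNIV smooth_ln" "continuous_on UNIV smooth_ln'"
    using smooth_ln_deriv smooth_ln'_deriv
    by (auto intro!: continuous_at_imp_continuous_on DERIV_isCont)
  note comp = csl[THEN continuous_on_compose2] continuous_on_smooth_ln''[of UNIV, THEN continuous_on_compose2]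
  interpret rotating_strip
    "\<lambda>t h. smooth_ln (y t h)" "\<lambda>t h. smooth_ln' (y t h) * yt t h" "\<lambda>t h. smooth_ln' (y t h) * yh t h"
    "\<lambda>t h. smooth_ln'' (y t h) * (yt t h)\<^sup>2 + smooth_ln' (y t h) * ytt t h"
    "\<lambda>t h. smooth_ln'' (y t h) * (yh t h)\<^sup>2 + smooth_ln' (y t h) * yhh t h" S C
  proof
    fix t h
    show "((\<lambda>t. smooth_ln (y t h)) has_real_derivative smooth_ln' (y t h) * yt t h) (at t)"
      "((\<lambda>h. smooth_ln (y t h)) has_real_derivative smooth_ln' (y t h) * yh t h) (at h)"
      by (intro DERIV_chain2[OF smooth_ln_deriv] y)+
    show "((\<lambda>t. smooth_ln' (y t h) * yt t h) has_real_derivative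
        smooth_ln'' (y t h) * (yt t h)\<^sup>2 + smooth_ln' (y t h) * ytt t h) (at t)"
      "((\<lambda>h. smooth_ln' (y t h) * yh t h) has_real_derivative
        smooth_ln'' (y t h) * (yh t h)\<^sup>2 + smooth_ln' (y t h) * yhh t h) (at h)"
      by (auto intro!: derivative_eq_intros DERIV_chain2[OF smooth_ln'_deriv] y simp: power2_eq_square)
    show "smooth_ln (y t (h + 2 * pi)) = smooth_ln (y t h)"
      "smooth_ln' (y t (h + 2 * pi)) * yh t (h + 2 * pi) = smooth_ln' (y t h) * yh t h"
      by (simp_all only: y_def yh_def perPQ)
    show "smooth_ln (y t h) \<ge> 0" by (rule smooth_ln_nonneg)
    show "smooth_ln (y t h) = 0" if "S t \<le> h" "h \<le> S t + pi"
      using le1[OF that] by (intro smooth_ln_eq_0) (simp add: y_norm power_le_one)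
    show "smooth_ln (y t h) \<le> C * (1 + exp t)"
      using order_trans[OF smooth_ln_le growth] by (simp add: y_norm)
    show "0 \<le> smooth_ln'' (y t h) * (yt t h)\<^sup>2 + smooth_ln' (y t h) * ytt t h
        + (smooth_ln'' (y t h) * (yh t h)\<^sup>2 + smooth_ln' (y t h) * yhh t h)"
    proof -
      \<comment> \<open>For y = |F|^2: the squared gradient is 4 |F'|^2 y and the Laplacian is 4
        |F'|^2, the terms with F'' cancelling. This leaves the factor treated in
        \<open>smooth_ln_convexity\<close>.\<close>
      have D: "(yt t h)\<^sup>2 + (yh t h)\<^sup>2 = 4 * ((P1 t h)\<^sup>2 + (Q1 t h)\<^sup>2) * y t h"
        "ytt t h + yhh t h = 4 * ((P1 t h)\<^sup>2 + (Q1 t h)\<^sup>2)"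
        by (simp_all add: y_def yt_def yh_def ytt_def yhh_def power2_eq_square algebra_simps)
      have "smooth_ln'' (y t h) * ((yt t h)\<^sup>2 + (yh t h)\<^sup>2) + smooth_ln' (y t h) * (ytt t h + yhh t h)
          = 4 * ((P1 t h)\<^sup>2 + (Q1 t h)\<^sup>2) * (y t h * smooth_ln'' (y t h) + smooth_ln' (y t h))"
        unfolding D by (simp add: algebra_simps)
      also have "\<dots> \<ge> 0" by (intro mult_nonneg_nonneg smooth_ln_convexity) auto
      finally show ?thesis by (simp add: algebra_simps)
    qed
  qed (unfold split_beta y_def yt_def yh_def ytt_def yhh_def, (intro continuous_intros comp cont S; simp)+)
  have "smooth_ln (y (Re z) (Im z)) = 0" by (rule fast_rotation_imp_zero) fact+
  then have "y (Re z) (Im z) \<le> 1" using smooth_ln_pos[of "y (Re z) (Im z)"] by linarith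
  then show ?thesis by (simp add: y_norm power_le_one_iff abs_square_le_1)
qed

section \<open>Entire functions bounded on a rotating half-plane\<close>

theorem theorem1p5:
  fixes s :: "real \<Rightarrow> real" and f :: "complex \<Rightarrow> complex"
  assumes "mono_on {0<..} s"
    and "continuous_on {0<..} s"
    and "f holomorphic_on UNIV"
    and "finite_exponential_type f"
    and "bounded (f ` rotating_half_plane s)"
    and "Limsup at_top (\<lambda>r::real. ereal (s r / sqrt (ln r))) > 0"
  shows "f constant_on UNIV"
proof -
  obtain A B where AB: "A > 0" "B > 0" "\<And>z. norm (f z) \<le> A * exp (B * norm z)"
    using assms(4) unfolding finite_exponential_type_def by blast
  obtain M where "M > 0" and M: "\<And>z. z \<in> rotating_half_plane s \<Longrightarrow> norm (f z) \<le> M"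
    using assms(5) unfolding bounded_pos by auto
  define S where "S = (\<lambda>t. s (exp t))"
  have "mono S"
    unfolding S_def by (rule monoI, rule mono_onD[OF assms(1)]) auto
  have contS: "continuous_on UNIV S"
    unfolding S_def by (intro continuous_on_compose2[OF assms(2)] continuous_intros) auto
  define f1 where "f1 = deriv f"
  define f2 where "f2 = deriv f1"
  have f1_hol: "f1 holomorphic_on UNIV" unfolding f1_def by (intro holomorphic_deriv assms) auto
  have f2_hol: "f2 holomorphic_on UNIV" unfolding f2_def by (intro holomorphic_deriv f1_hol) auto
  have df: "(f has_field_derivative f1 z) (at z)" "(f1 has_field_derivative f2 z) (at z)" for z
    unfolding f1_def f2_def using holomorphic_derivI[OF assms(3)] holomorphic_derivI[OF f1_hol]
    by (auto simp: f1_def)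
  \<comment> \<open>Division by \<open>M\<close> makes the bound on the half-plane 1, the threshold
    below which Psi vanishes.\<close>
  define F where "F = (\<lambda>z. f (exp z) / M)"
  define F1 where "F1 = (\<lambda>z. f1 (exp z) * exp z / M)"
  define F2 where "F2 = (\<lambda>z. (f2 (exp z) * exp z * exp z + f1 (exp z) * exp z) / M)"
  \<comment> \<open>The half-plane is open, but Wirtinger's inequality requires zeros at the ends of
    the strip; continuity passes to the closure.\<close>
  have le: "norm (f (exp (Complex t h))) \<le> M" if h: "S t \<le> h" "h \<le> S t + pi" for t h
  proof -
    have "norm (f (exp (Complex t x))) \<le> M" if "x \<in> {S t<..<S t + pi}" for x
    proof (rule M)
      have "exp (Complex t x) = complex_of_real (exp t) * exp (\<i> * complex_of_real x)"
        by (simp add: Complex_eq exp_add exp_of_real)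
      then show "exp (Complex t x) \<in> rotating_half_plane s"
        unfolding rotating_half_plane_def using that S_def
        by (intro CollectI exI[of _ "exp t"] exI[of _ x]) auto
    qed
    moreover have "continuous_on (closure {S t<..<S t + pi}) (\<lambda>x. norm (f (exp (Complex t x))))"
      unfolding Complex_eq
      by (rule continuous_on_norm, rule continuous_on_compose2[of UNIV f],
          rule holomorphic_on_imp_continuous_on, rule assms) (auto intro!: continuous_intros)
    moreover have "h \<in> closure {S t<..<S t + pi}"
      using h by simp
    ultimately show ?thesis using continuous_le_on_closure by blast
  qed
  \<comment> \<open>The 2 comes from |F|^2; the absolute value keeps the constant nonnegative when A
    < M.\<close>
  define c0 where "c0 = 2 * (\<bar>ln (A / M)\<bar> + B)"
  have "\<exists>c>0. \<exists>\<^sub>F t in at_top. c * sqrt t \<le> S t"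
  proof -
    obtain c :: real where c: "0 < c" "ereal c < Limsup at_top (\<lambda>r::real. ereal (s r / sqrt (ln r)))"
      using ereal_dense2[OF assms(6)] by (auto simp: zero_ereal_def)
    \<comment> \<open>With t = ln r, an eventual bound c sqrt t would cap the Limsup at c.\<close>
    have False if "\<forall>\<^sub>F t in at_top. S t < c * sqrt t"
    proof -
      have "\<forall>\<^sub>F r in at_top. S (ln r) < c * sqrt (ln r)"
        using filterlim_iff[THEN iffD1, OF ln_at_top] that by blast
      then have "\<forall>\<^sub>F r in at_top. ereal (s r / sqrt (ln r)) \<le> ereal c"
        using eventually_gt_at_top[of 1]
      proof eventually_elim
        case (elim r)
        then have "s r < c * sqrt (ln r)" "sqrt (ln r) > 0" by (auto simp: S_def)
        then show ?case by (simp add: field_simps)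
      qed
      then have "Limsup at_top (\<lambda>r::real. ereal (s r / sqrt (ln r))) \<le> ereal c"
        by (rule Limsup_bounded)
      with c show False by simp
    qed
    then show ?thesis using c(1) by (auto simp: frequently_def not_le)
  qed
  then obtain c where c: "c > 0" "\<exists>\<^sub>F t in at_top. c * sqrt t \<le> S t" by blast
  have F_le: "norm (F z) \<le> 1" for z
  proof (rule holomorphic_rotating_strip[where S = S and C = c0 and c = c and F = F and dF = F1 and ddF = F2])
    show "(F has_field_derivative F1 z) (at z)" for z
      unfolding F_def F1_def using \<open>M > 0\<close>
      by (auto intro!: derivative_eq_intros DERIV_chain2[OF df(1)])
    show "(F1 has_field_derivative F2 z) (at z)" for z
      unfolding F1_def F2_def using \<open>M > 0\<close>
      by (auto intro!: derivative_eq_intros DERIV_chain2[OF df(2)])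
    show "continuous_on UNIV F2"
    proof -
      have "continuous_on UNIV (\<lambda>z. g (exp z))" if "g holomorphic_on UNIV" for g :: "complex \<Rightarrow> complex"
        by (rule continuous_on_compose2[of UNIV g], rule holomorphic_on_imp_continuous_on, rule that)
          (auto intro!: continuous_intros)
      from this[OF f1_hol] this[OF f2_hol] show ?thesis
        unfolding F2_def using \<open>M > 0\<close> by (auto intro!: continuous_intros)
    qed
    have "exp (z + 2 * of_real pi * \<i>) = exp z" for z :: complex
      by (simp add: exp_add)
    then show "F (z + 2 * of_real pi * \<i>) = F z" "F1 (z + 2 * of_real pi * \<i>) = F1 z" for z
      by (simp_all add: F_def F1_def)
    show "norm (F (Complex t h)) \<le> 1" if "S t \<le> h" "h \<le> S t + pi" for t h
      using le[OF that] \<open>M > 0\<close> by (simp add: F_def norm_divide)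
    show "ln (max 1 ((norm (F (Complex t h)))\<^sup>2)) \<le> c0 * (1 + exp t)" for t h
    proof -
      have "norm (F (Complex t h)) \<le> A / M * exp (B * exp t)"
        using AB(3)[of "exp (Complex t h)"] \<open>M > 0\<close> by (simp add: F_def norm_divide divide_right_mono)
      also have "\<dots> = exp (ln (A / M) + B * exp t)" using AB \<open>M > 0\<close> by (simp add: exp_add)
      finally have "(norm (F (Complex t h)))\<^sup>2 \<le> (exp (ln (A / M) + B * exp t))\<^sup>2"
        by (intro power_mono) auto
      also have "\<dots> = exp (2 * (ln (A / M) + B * exp t))" by (simp flip: exp_double)
      also have "\<dots> \<le> exp (c0 * (1 + exp t))"
      proof -
        define l where "l = \<bar>ln (A / M)\<bar>"
        have "c0 * (1 + exp t) - 2 * (ln (A / M) + B * exp t)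
            = 2 * (l - ln (A / M)) + 2 * (l * exp t) + 2 * B"
          by (simp add: c0_def l_def algebra_simps)
        also have "\<dots> \<ge> 0"
          using AB(2) by (intro add_nonneg_nonneg mult_nonneg_nonneg) (auto simp: l_def)
        finally have "2 * (ln (A / M) + B * exp t) \<le> c0 * (1 + exp t)" by simp
        then show ?thesis by simp
      qed
      finally have "(norm (F (Complex t h)))\<^sup>2 \<le> exp (c0 * (1 + exp t))" .
      moreover have "1 \<le> exp (c0 * (1 + exp t))" using AB by (simp add: c0_def)
      ultimately have "ln (max 1 ((norm (F (Complex t h)))\<^sup>2)) \<le> ln (exp (c0 * (1 + exp t)))"
        by (intro ln_mono) auto
      then show ?thesis by simp
    qed
  qed (use \<open>mono S\<close> contS c in auto)
  \<comment> \<open>The exponential omits 0, so the value there enters separately.\<close>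
  have "norm (f z) \<le> max M (norm (f 0))" for z
  proof (cases "z = 0")
    case False
    then have "F (Ln z) = f z / M" by (simp add: F_def)
    then show ?thesis using F_le[of "Ln z"] \<open>M > 0\<close> by (simp add: norm_divide)
  qed simp
  then have "bounded (range f)" unfolding bounded_iff by blast
  then show ?thesis by (rule Liouville_theorem[OF assms(3)])
qed

end
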